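(* Let $\delta\ge 2$ be an integer and let $G$ be a connected graph of order $n\ge \max\{8\delta,\ \tfrac12\delta^2+2\delta+2\}$ with minimum degree $\delta$. If $$\lambda_1(D(G))\le \lambda_1\big(D(K_\delta\vee(K_{n-2\delta}+\delta K_1))\big),$$ then $G$ is 1-tough, unless $G\cong K_\delta\vee(K_{n-2\delta}+\delta K_1)$.
   Context: All graphs are finite, simple and undirected. For a connected graph $G$ with vertices $v_1,\dots,v_n$, the distance matrix $D(G)$ is the $n\times n$ matrix whose $(i,j)$-entry is the distance (length of a shortest path) between $v_i$ and $v_j$ (zero on the diagonal); $\lambda_1(D(G))$ denotes its largest eigenvalue, the distance spectral radius. $c(H)$ is the number of connected components of $H$. For $G\not\cong K_n$, the toughness is $\tau(G)=\min\{|S|/c(G-S): S\subseteq V(G)\text{ a vertex cut}\}$; $G$ is $t$-tough if $\tau(G)\ge t$. $K_m$ is the complete graph on $m$ vertices, $G_1+G_2$ is the disjoint union, $sH$ is the disjoint union of $s$ copies of $H$, and $G_1\vee G_2$ (join) is obtained from $G_1+G_2$ by adding all edges between $V(G_1)$ and $V(G_2)$. *)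

theory Defs
  imports Complex_Main
begin

definition graph :: "'a set \<Rightarrow> ('a \<Rightarrow> 'a \<Rightarrow> bool) \<Rightarrow> bool" where
  "graph V E \<longleftrightarrow> finite V \<and> (\<forall>u v. E u v \<longrightarrow> u \<in> V \<and> v \<in> V)
     \<and> (\<forall>u v. E u v \<longrightarrow> E v u) \<and> (\<forall>v. \<not> E v v)"

definition adj_in :: "'a set \<Rightarrow> ('a \<Rightarrow> 'a \<Rightarrow> bool) \<Rightarrow> 'a \<Rightarrow> 'a \<Rightarrow> bool" where
  "adj_in W E u v \<longleftrightarrow> u \<in> W \<and> v \<in> W \<and> E u v"

definition connected_graph :: "'a set \<Rightarrow> ('a \<Rightarrow> 'a \<Rightarrow> bool) \<Rightarrow> bool" where
  "connected_graph V E \<longleftrightarrow> V \<noteq> {} \<and> (\<forall>u\<in>V. \<forall>v\<in>V. (adj_in V E)\<^sup>*\<^sup>* u v)"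

definition degree :: "'a set \<Rightarrow> ('a \<Rightarrow> 'a \<Rightarrow> bool) \<Rightarrow> 'a \<Rightarrow> nat" where
  "degree V E v = card {u \<in> V. E v u}"

definition min_degree :: "'a set \<Rightarrow> ('a \<Rightarrow> 'a \<Rightarrow> bool) \<Rightarrow> nat" where
  "min_degree V E = Min (degree V E ` V)"

definition gdist :: "'a set \<Rightarrow> ('a \<Rightarrow> 'a \<Rightarrow> bool) \<Rightarrow> 'a \<Rightarrow> 'a \<Rightarrow> nat" where
  "gdist V E u v = (LEAST k. (adj_in V E ^^ k) u v)"

definition dist_eigenvalues :: "'a set \<Rightarrow> ('a \<Rightarrow> 'a \<Rightarrow> bool) \<Rightarrow> real set" where
  "dist_eigenvalues V E = {\<mu>. \<exists>x :: 'a \<Rightarrow> real. (\<exists>v\<in>V. x v \<noteq> 0) \<and>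
      (\<forall>u\<in>V. (\<Sum>v\<in>V. real (gdist V E u v) * x v) = \<mu> * x u)}"

definition dist_spectral_radius :: "'a set \<Rightarrow> ('a \<Rightarrow> 'a \<Rightarrow> bool) \<Rightarrow> real" where
  "dist_spectral_radius V E = Max (dist_eigenvalues V E)"

definition components :: "'a set \<Rightarrow> ('a \<Rightarrow> 'a \<Rightarrow> bool) \<Rightarrow> 'a set set" where
  "components W E = (\<lambda>v. {u \<in> W. (adj_in W E)\<^sup>*\<^sup>* v u}) ` W"

definition num_components :: "'a set \<Rightarrow> ('a \<Rightarrow> 'a \<Rightarrow> bool) \<Rightarrow> nat" where
  "num_components W E = card (components W E)"

definition complete_graph :: "'a set \<Rightarrow> ('a \<Rightarrow> 'a \<Rightarrow> bool) \<Rightarrow> bool" where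
  "complete_graph V E \<longleftrightarrow> (\<forall>u\<in>V. \<forall>v\<in>V. u \<noteq> v \<longrightarrow> E u v)"

definition vertex_cut :: "'a set \<Rightarrow> ('a \<Rightarrow> 'a \<Rightarrow> bool) \<Rightarrow> 'a set \<Rightarrow> bool" where
  "vertex_cut V E S \<longleftrightarrow> S \<subseteq> V \<and> num_components (V - S) E \<ge> 2"

definition toughness :: "'a set \<Rightarrow> ('a \<Rightarrow> 'a \<Rightarrow> bool) \<Rightarrow> real" where
  "toughness V E = Min {real (card S) / real (num_components (V - S) E) | S. vertex_cut V E S}"

text \<open>t-tough: toughness at least t; complete graphs (toughness undefined / infinite
  by convention) are t-tough for every t.\<close>
definition tough :: "'a set \<Rightarrow> ('a \<Rightarrow> 'a \<Rightarrow> bool) \<Rightarrow> real \<Rightarrow> bool" where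
  "tough V E t \<longleftrightarrow> complete_graph V E \<or> toughness V E \<ge> t"

definition graph_iso :: "'a set \<Rightarrow> ('a \<Rightarrow> 'a \<Rightarrow> bool) \<Rightarrow> 'b set \<Rightarrow> ('b \<Rightarrow> 'b \<Rightarrow> bool) \<Rightarrow> bool" where
  "graph_iso V E W F \<longleftrightarrow> (\<exists>f. bij_betw f V W \<and> (\<forall>u\<in>V. \<forall>v\<in>V. E u v \<longleftrightarrow> F (f u) (f v)))"

text \<open>The graph K_d \<or> (K_{n-2d} + d K_1) on vertex set {0..<n}:
  {0..<d} is the K_d, {d..<n-d} is the K_{n-2d}, {n-d..<n} are the d isolated K_1.\<close>
definition extremal_vertices :: "nat \<Rightarrow> nat set" where
  "extremal_vertices n = {0..<n}"

definition extremal_adj :: "nat \<Rightarrow> nat \<Rightarrow> nat \<Rightarrow> nat \<Rightarrow> bool" where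
  "extremal_adj n d u v \<longleftrightarrow> u < n \<and> v < n \<and> u \<noteq> v \<and>
     (u < d \<or> v < d \<or> (d \<le> u \<and> u < n - d \<and> d \<le> v \<and> v < n - d))"

end

theory Submission
  imports "HOL-Analysis.Function_Topology" Defs
begin

text \<open>
  If \<open>G\<close> is not 1-tough, there is a set \<open>S\<close> of \<open>s \<ge> 1\<close> vertices such that \<open>G - S\<close> splits into
  \<open>s + 1\<close> nonempty parts without edges between them, so two vertices in distinct parts have
  distance at least 2. By Rayleigh's principle it suffices to put positive weights \<open>x\<close> on the vertices
  such that the total of \<open>x\<^sub>u x\<^sub>v\<close> over these pairs is large. For \<open>s < \<delta>\<close> (where the minimum degree
  makes every part have more than \<open>\<delta> - s\<close> vertices), for \<open>s = \<delta>\<close>, and for \<open>s > \<delta>\<close> with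
  \<open>n - 2s \<ge> 2\<delta>\<close>, the weights are those of the Perron vector of the extremal graph, rearranged; they
  differ from each other by a factor less than 2, which is what the comparison needs, and equality
  only occurs for the extremal graph. In the remaining range the weight \<open>3/2\<close> on one vertex of each
  part but the largest, and 1 elsewhere, beats the explicit upper bound \<open>1.273 n\<close> for one plus the
  spectral radius of the extremal graph.
\<close>

section \<open>Symmetric matrices indexed by a finite set\<close>

text \<open>Bessel's inequality for the standard unit vector at \<open>v\<close>. With
  \<open>?p\<close> its projection onto the span of the orthonormal family, the squared norm of the
  difference is 1 minus the left-hand side.\<close>

lemma bessel_at_coordinate:
  fixes e :: "'b \<Rightarrow> 'a \<Rightarrow> real"
  assumes "finite V" "finite F" "v \<in> V"
    and orth: "\<And>i j. i \<in> F \<Longrightarrow> j \<in> F \<Longrightarrow> (\<Sum>u\<in>V. e i u * e j u) = (if i = j then 1 else 0)"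
  shows "(\<Sum>i\<in>F. (e i v)\<^sup>2) \<le> 1"
proof -
  let ?d = "\<lambda>u. if u = v then 1 else (0::real)"
  let ?p = "\<lambda>u. \<Sum>i\<in>F. e i v * e i u"
  have pd: "(\<Sum>u\<in>V. ?d u * ?p u) = (\<Sum>i\<in>F. (e i v)\<^sup>2)"
  proof -
    have "(\<Sum>u\<in>V. ?d u * ?p u) = (\<Sum>u\<in>V. if v = u then ?p u else 0)"
      by (rule sum.cong) auto
    also have "\<dots> = ?p v" using assms by simp
    finally show ?thesis by (simp add: power2_eq_square)
  qed
  have pp: "(\<Sum>u\<in>V. ?p u * ?p u) = (\<Sum>i\<in>F. (e i v)\<^sup>2)"
  proof -
    have "(\<Sum>u\<in>V. ?p u * ?p u) = (\<Sum>u\<in>V. \<Sum>i\<in>F. \<Sum>j\<in>F. (e i v * e j v) * (e i u * e j u))"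
      by (simp add: sum_product mult_ac)
    also have "\<dots> = (\<Sum>i\<in>F. \<Sum>u\<in>V. \<Sum>j\<in>F. (e i v * e j v) * (e i u * e j u))"
      by (rule sum.swap)
    also have "\<dots> = (\<Sum>i\<in>F. \<Sum>j\<in>F. \<Sum>u\<in>V. (e i v * e j v) * (e i u * e j u))"
      by (intro sum.cong refl sum.swap)
    also have "\<dots> = (\<Sum>i\<in>F. \<Sum>j\<in>F. (e i v * e j v) * (\<Sum>u\<in>V. e i u * e j u))"
      by (simp add: sum_distrib_left)
    also have "\<dots> = (\<Sum>i\<in>F. \<Sum>j\<in>F. if i = j then e i v * e j v else 0)"
      by (intro sum.cong refl) (simp add: orth)
    also have "\<dots> = (\<Sum>i\<in>F. (e i v)\<^sup>2)"
      using assms by (simp add: power2_eq_square)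
    finally show ?thesis .
  qed
  have dd: "(\<Sum>u\<in>V. ?d u * ?d u) = 1"
  proof -
    have "(\<Sum>u\<in>V. ?d u * ?d u) = (\<Sum>u\<in>V. if v = u then 1 else 0)"
      by (rule sum.cong) auto
    then show ?thesis using assms by simp
  qed
  have "0 \<le> (\<Sum>u\<in>V. (?d u - ?p u)\<^sup>2)" by (simp add: sum_nonneg)
  also have "\<dots> = (\<Sum>u\<in>V. ?d u * ?d u + ?p u * ?p u - 2 * (?d u * ?p u))"
    by (intro sum.cong refl) (simp add: power2_eq_square algebra_simps)
  also have "\<dots> = (\<Sum>u\<in>V. ?d u * ?d u) + (\<Sum>u\<in>V. ?p u * ?p u) - 2 * (\<Sum>u\<in>V. ?d u * ?p u)"
    by (simp only: sum.distrib sum_subtractf sum_distrib_left)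
  finally show ?thesis using pd pp dd by linarith
qed

text \<open>Infinitely many eigenvalues would provide \<open>card V + 1\<close> normalised
  eigenvectors, orthogonal because \<open>M\<close> is symmetric. Summing Bessel's inequality over
  all coordinates then bounds their number by \<open>card V\<close>.\<close>

lemma finite_symmetric_spectrum:
  fixes M :: "'a \<Rightarrow> 'a \<Rightarrow> real"
  assumes fin: "finite V" and sym: "\<And>u v. u \<in> V \<Longrightarrow> v \<in> V \<Longrightarrow> M u v = M v u"
  shows "finite {\<mu>. \<exists>x. (\<exists>v\<in>V. x v \<noteq> 0) \<and> (\<forall>u\<in>V. (\<Sum>v\<in>V. M u v * x v) = \<mu> * x u)}"
    (is "finite ?Sp")
proof (rule ccontr)
  assume inf: "infinite ?Sp"
  have "\<exists>x. (\<Sum>v\<in>V. x v * x v) = 1 \<and> (\<forall>u\<in>V. (\<Sum>v\<in>V. M u v * x v) = \<mu> * x u)" if "\<mu> \<in> ?Sp" for \<mu>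
  proof -
    from that obtain x v where x: "v \<in> V" "x v \<noteq> 0"
      "\<And>u. u \<in> V \<Longrightarrow> (\<Sum>v\<in>V. M u v * x v) = \<mu> * x u" by blast
    define N where "N = (\<Sum>v\<in>V. x v * x v)"
    have "N > 0" unfolding N_def using x fin
      by (intro sum_pos2[of V v]) (auto simp: zero_less_mult_iff)
    then have "(\<Sum>v\<in>V. (x v / sqrt N) * (x v / sqrt N)) = 1"
      by (simp add: N_def[symmetric] flip: sum_divide_distrib)
    moreover have "(\<Sum>v\<in>V. M u v * (x v / sqrt N)) = \<mu> * (x u / sqrt N)" if "u \<in> V" for u
      using x(3)[OF that] by (simp flip: sum_divide_distrib)
    ultimately show ?thesis by (intro exI[of _ "\<lambda>v. x v / sqrt N"]) blast
  qed
  then have "\<forall>\<mu>\<in>?Sp. \<exists>x. (\<Sum>v\<in>V. x v * x v) = 1 \<and> (\<forall>u\<in>V. (\<Sum>v\<in>V. M u v * x v) = \<mu> * x u)"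
    by blast
  from bchoice[OF this] obtain e where e1: "\<And>\<mu>. \<mu> \<in> ?Sp \<Longrightarrow> (\<Sum>v\<in>V. e \<mu> v * e \<mu> v) = 1"
    and e2: "\<And>\<mu> u. \<mu> \<in> ?Sp \<Longrightarrow> u \<in> V \<Longrightarrow> (\<Sum>v\<in>V. M u v * e \<mu> v) = \<mu> * e \<mu> u"
    by blast
  obtain F where F: "F \<subseteq> ?Sp" "finite F" "card F = Suc (card V)"
    using infinite_arbitrarily_large[OF inf] by blast
  have e2F: "(\<Sum>v\<in>V. M u v * e i v) = i * e i u" if "i \<in> F" "u \<in> V" for i u
    using F(1) that by (intro e2) auto
  have orth: "(\<Sum>u\<in>V. e i u * e j u) = (if i = j then 1 else 0)" if "i \<in> F" "j \<in> F" for i j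
  proof (cases "i = j")
    case True
    have "i \<in> ?Sp" using F(1) that by blast
    from e1[OF this] True show ?thesis by simp
  next
    case False
    have "j * (\<Sum>u\<in>V. e i u * e j u) = (\<Sum>u\<in>V. e i u * (\<Sum>v\<in>V. M u v * e j v))"
      using that by (simp add: e2F sum_distrib_left mult_ac)
    also have "\<dots> = (\<Sum>u\<in>V. \<Sum>v\<in>V. e i u * M u v * e j v)"
      by (simp add: sum_distrib_left mult.assoc)
    also have "\<dots> = (\<Sum>v\<in>V. \<Sum>u\<in>V. e i u * M u v * e j v)" by (rule sum.swap)
    also have "\<dots> = (\<Sum>v\<in>V. e j v * (\<Sum>u\<in>V. M v u * e i u))"
      by (simp add: sum_distrib_left mult_ac sym)
    also have "\<dots> = i * (\<Sum>u\<in>V. e i u * e j u)"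
      using that by (simp add: e2F sum_distrib_left mult_ac)
    finally show ?thesis using False by simp
  qed
  have "real (card F) = (\<Sum>i\<in>F. \<Sum>v\<in>V. (e i v)\<^sup>2)"
    using orth by (simp add: power2_eq_square)
  also have "\<dots> = (\<Sum>v\<in>V. \<Sum>i\<in>F. (e i v)\<^sup>2)" by (rule sum.swap)
  also have "\<dots> \<le> (\<Sum>v\<in>V. 1)"
    by (rule sum_mono) (rule bessel_at_coordinate[OF fin F(2) _ orth])
  finally show False using F(3) by simp
qed

section \<open>Variational characterisation of the largest eigenvalue\<close>

text \<open>First-order condition at a maximum: for \<open>t\<close> a small multiple of
  \<open>p\<close> the linear term would dominate the quadratic one.\<close>

lemma linear_coeff_zero_if_quadratic_nonpos:
  fixes p q :: real
  assumes "\<And>t. 2 * t * p + t\<^sup>2 * q \<le> 0"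
  shows "p = 0"
proof (rule ccontr)
  assume "p \<noteq> 0"
  define t where "t = p / (1 + \<bar>q\<bar>)"
  have pos: "1 + \<bar>q\<bar> > 0" by simp
  have tp: "p = t * (1 + \<bar>q\<bar>)" using pos by (simp add: t_def)
  have "t \<noteq> 0" using \<open>p \<noteq> 0\<close> tp by auto
  have "2 * t * p + t\<^sup>2 * q = t\<^sup>2 * (2 + 2 * \<bar>q\<bar> + q)"
    by (subst tp) (simp add: power2_eq_square algebra_simps)
  also have "\<dots> > 0" using \<open>t \<noteq> 0\<close> by (intro mult_pos_pos) auto
  finally show False using assms[of t] by simp
qed

text \<open>The quadratic form attains its maximum on the unit sphere by compactness; homogeneity
  extends the bound to all \<open>y\<close>, and stationarity in each coordinate direction is the
  eigenvalue equation.\<close>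

lemma rayleigh_quotient_attained:
  fixes M :: "'a \<Rightarrow> 'a \<Rightarrow> real"
  assumes fin: "finite V" and ne: "V \<noteq> {}"
    and sym: "\<And>u v. u \<in> V \<Longrightarrow> v \<in> V \<Longrightarrow> M u v = M v u"
  shows "\<exists>x \<mu>. (\<exists>v\<in>V. x v \<noteq> 0) \<and> (\<forall>u\<in>V. (\<Sum>v\<in>V. M u v * x v) = \<mu> * x u) \<and>
    (\<forall>y. (\<Sum>u\<in>V. \<Sum>v\<in>V. M u v * (y u * y v)) \<le> \<mu> * (\<Sum>u\<in>V. (y u)\<^sup>2))"
proof -
  define Q where "Q y = (\<Sum>u\<in>V. \<Sum>v\<in>V. M u v * (y u * y v))" for y
  define N where "N y = (\<Sum>u\<in>V. (y u)\<^sup>2)" for y :: "'a \<Rightarrow> real"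
  \<comment> \<open>Vectors are functions on the whole type, so the coordinates outside
    \<open>V\<close> are pinned to 0. The resulting box is compact by Tychonoff's theorem, even for
    an infinite type, and contains a representative of every unit vector.\<close>
  define B where "B = PiE UNIV (\<lambda>u. if u \<in> V then {-1..1} else {0::real})"
  have cont: "continuous_on UNIV (\<lambda>y::'a \<Rightarrow> real. y u)" for u
    by (rule continuous_on_product_coordinates)
  have contQ: "continuous_on A Q" for A unfolding Q_def
    by (intro continuous_intros continuous_on_subset[OF cont]) auto
  have contN: "continuous_on A N" for A unfolding N_def
    by (intro continuous_intros continuous_on_subset[OF cont]) auto
  have "compact B"
  proof -
    have "compactin (product_topology (\<lambda>i. euclidean) UNIV) B"
      unfolding B_def by (subst compactin_PiE) auto
    then show ?thesis by (simp add: euclidean_product_topology)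
  qed
  moreover have "closed {y. N y = 1}"
    by (intro closed_Collect_eq contN continuous_on_const)
  ultimately have "compact (B \<inter> {y. N y = 1})" by (rule compact_Int_closed)
  moreover obtain w where "w \<in> V" using ne by blast
  have "(\<lambda>u. if u = w then 1 else 0) \<in> B \<inter> {y. N y = 1}"
  proof -
    have "N (\<lambda>u. if u = w then 1 else 0) = (\<Sum>u\<in>V. if w = u then 1 else 0)"
      unfolding N_def by (rule sum.cong) auto
    then show ?thesis using \<open>w \<in> V\<close> fin by (auto simp: B_def)
  qed
  ultimately have "\<exists>x \<in> B \<inter> {y. N y = 1}. \<forall>y \<in> B \<inter> {y. N y = 1}. Q y \<le> Q x"
    by (intro continuous_attains_sup contQ) auto
  then obtain x where x: "x \<in> B" "N x = 1" and
    max: "\<And>y. y \<in> B \<Longrightarrow> N y = 1 \<Longrightarrow> Q y \<le> Q x"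
    by blast
  have ray: "Q y \<le> Q x * N y" for y
  proof (cases "N y = 0")
    case True
    then have "y u = 0" if "u \<in> V" for u
      using that fin unfolding N_def by (subst (asm) sum_nonneg_eq_0_iff) auto
    then show ?thesis using True by (simp add: Q_def)
  next
    case False
    then have pos: "N y > 0" unfolding N_def by (simp add: sum_nonneg order.not_eq_order_implies_strict)
    define z where "z = (\<lambda>u. if u \<in> V then y u / sqrt (N y) else 0)"
    have Nz: "N z = 1"
    proof -
      have "N z = (\<Sum>u\<in>V. (y u)\<^sup>2 / N y)" unfolding N_def[of z]
        by (rule sum.cong) (use pos in \<open>auto simp: z_def power_divide\<close>)
      then show ?thesis using pos by (simp add: N_def flip: sum_divide_distrib)
    qed
    have "z u \<in> {-1..1}" if "u \<in> V" for u
    proof -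
      have "(z u)\<^sup>2 \<le> N z" unfolding N_def using that fin by (intro member_le_sum) auto
      then show ?thesis using Nz by (auto simp: abs_square_le_1 abs_le_iff)
    qed
    then have "z \<in> B" by (auto simp: B_def z_def)
    then have "Q z \<le> Q x" using max Nz by blast
    moreover have "Q z = Q y / N y"
    proof -
      have "Q z = (\<Sum>u\<in>V. \<Sum>v\<in>V. M u v * (y u * y v) / N y)" unfolding Q_def
        by (intro sum.cong refl) (use pos in \<open>auto simp: z_def\<close>)
      then show ?thesis by (simp add: Q_def sum_divide_distrib)
    qed
    ultimately show ?thesis using pos by (simp add: field_simps)
  qed
  have eig: "(\<Sum>v\<in>V. M u v * x v) = Q x * x u" if "u \<in> V" for u
  proof -
    let ?d = "\<lambda>v. if v = u then 1 else (0::real)"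
    have d: "(\<Sum>v\<in>V. g v * ?d v) = g u" for g
    proof -
      have "(\<Sum>v\<in>V. g v * ?d v) = (\<Sum>v\<in>V. if u = v then g v else 0)"
        by (rule sum.cong) auto
      then show ?thesis using that fin by simp
    qed
    have NN: "N (\<lambda>v. x v + t * ?d v) = 1 + 2 * t * x u + t\<^sup>2" for t
    proof -
      have "N (\<lambda>v. x v + t * ?d v) = (\<Sum>v\<in>V. (x v)\<^sup>2 + (2 * t * x v + t\<^sup>2) * ?d v)"
        unfolding N_def by (intro sum.cong refl) (auto simp: power2_eq_square algebra_simps)
      also have "\<dots> = N x + (2 * t * x u + t\<^sup>2)"
        unfolding sum.distrib d N_def by simp
      finally show ?thesis using x by simp
    qed
    have QQ: "Q (\<lambda>v. x v + t * ?d v) = Q x + 2 * t * (\<Sum>v\<in>V. M u v * x v) + t\<^sup>2 * M u u" for t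
    proof -
      have third: "(\<Sum>w\<in>V. \<Sum>v\<in>V. t * M w v * x v * ?d w) = (\<Sum>v\<in>V. t * M u v * x v)"
        unfolding sum_distrib_right[symmetric] d ..
      have "Q (\<lambda>v. x v + t * ?d v) = (\<Sum>w\<in>V. \<Sum>v\<in>V. M w v * (x w * x v) + (t * M w v * x w) * ?d v
           + t * M w v * x v * ?d w + (t\<^sup>2 * M w v * ?d w) * ?d v)"
        unfolding Q_def by (intro sum.cong refl) (auto simp: power2_eq_square algebra_simps)
      also have "\<dots> = Q x + (\<Sum>w\<in>V. t * M w u * x w) + (\<Sum>v\<in>V. t * M u v * x v) + t\<^sup>2 * M u u"
        unfolding sum.distrib third d Q_def ..
      also have "(\<Sum>w\<in>V. t * M w u * x w) = (\<Sum>w\<in>V. t * M u w * x w)"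
        using sym that by (intro sum.cong) auto
      finally show ?thesis by (simp add: sum_distrib_left mult_ac)
    qed
    \<comment> \<open>The perturbation of the maximiser by \<open>t\<close> times the unit vector at
      \<open>u\<close>; the linear coefficient, which must vanish, is the defect in row
      \<open>u\<close> of the eigenvalue equation.\<close>
    have "2 * t * ((\<Sum>v\<in>V. M u v * x v) - Q x * x u) + t\<^sup>2 * (M u u - Q x) \<le> 0" for t
      using ray[of "\<lambda>v. x v + t * ?d v"] unfolding NN QQ by (simp add: algebra_simps)
    from linear_coeff_zero_if_quadratic_nonpos[OF this] show ?thesis by simp
  qed
  have "\<exists>v\<in>V. x v \<noteq> 0"
  proof (rule ccontr)
    assume "\<not> ?thesis"
    then have "N x = 0" unfolding N_def by simp
    then show False using x by simp
  qed
  with eig ray show ?thesis unfolding Q_def N_def by blast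
qed

text \<open>The easy half of Perron's theorem: pair the entrywise inequality \<open>\<mu> * \<bar>y
  u\<bar> \<le> (\<Sum>v\<in>V. M u v * \<bar>y v\<bar>)\<close> with \<open>z\<close>, and move
  \<open>M\<close> over to \<open>z\<close> by symmetry.\<close>

lemma eigenvalue_le_of_positive_eigenvector:
  fixes M :: "'a \<Rightarrow> 'a \<Rightarrow> real"
  assumes fin: "finite V" and sym: "\<And>u v. u \<in> V \<Longrightarrow> v \<in> V \<Longrightarrow> M u v = M v u"
    and nn: "\<And>u v. u \<in> V \<Longrightarrow> v \<in> V \<Longrightarrow> M u v \<ge> 0"
    and z: "\<And>u. u \<in> V \<Longrightarrow> z u > 0" "\<And>u. u \<in> V \<Longrightarrow> (\<Sum>v\<in>V. M u v * z v) = \<rho> * z u"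
    and y: "w \<in> V" "y w \<noteq> 0" "\<And>u. u \<in> V \<Longrightarrow> (\<Sum>v\<in>V. M u v * y v) = \<mu> * y u"
  shows "\<mu> \<le> \<rho>"
proof -
  define p where "p = (\<Sum>u\<in>V. z u * \<bar>y u\<bar>)"
  have "p > 0" unfolding p_def
    by (rule sum_pos2[of V w]) (use assms in \<open>auto simp: less_imp_le\<close>)
  have "\<mu> * p = (\<Sum>u\<in>V. z u * (\<mu> * \<bar>y u\<bar>))" by (simp add: p_def sum_distrib_left mult_ac)
  also have "\<dots> \<le> (\<Sum>u\<in>V. z u * (\<Sum>v\<in>V. M u v * \<bar>y v\<bar>))"
  proof (intro sum_mono mult_left_mono)
    fix u assume u: "u \<in> V"
    have "\<mu> * \<bar>y u\<bar> \<le> \<bar>\<mu> * y u\<bar>" by (simp add: abs_mult mult_right_mono)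
    also have "\<dots> = \<bar>\<Sum>v\<in>V. M u v * y v\<bar>" using y(3)[OF u] by simp
    also have "\<dots> \<le> (\<Sum>v\<in>V. \<bar>M u v * y v\<bar>)" by (rule sum_abs)
    also have "\<dots> = (\<Sum>v\<in>V. M u v * \<bar>y v\<bar>)" using nn u by (simp add: abs_mult)
    finally show "\<mu> * \<bar>y u\<bar> \<le> (\<Sum>v\<in>V. M u v * \<bar>y v\<bar>)" .
    show "0 \<le> z u" using z(1)[OF u] by simp
  qed
  also have "\<dots> = (\<Sum>u\<in>V. \<Sum>v\<in>V. z u * M u v * \<bar>y v\<bar>)" by (simp add: sum_distrib_left mult.assoc)
  also have "\<dots> = (\<Sum>v\<in>V. \<Sum>u\<in>V. z u * M u v * \<bar>y v\<bar>)" by (rule sum.swap)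
  also have "\<dots> = (\<Sum>v\<in>V. \<bar>y v\<bar> * (\<Sum>u\<in>V. M v u * z u))"
    by (simp add: sum_distrib_left mult_ac sym)
  also have "\<dots> = \<rho> * p" using z(2) by (simp add: p_def sum_distrib_left mult_ac)
  finally show ?thesis using \<open>p > 0\<close> by simp
qed

section \<open>The distance matrix\<close>

lemma gdist_commute:
  assumes "graph V E"
  shows "gdist V E u v = gdist V E v u"
proof -
  have step: "adj_in V E w u \<Longrightarrow> adj_in V E u w" for u w
    using assms by (auto simp: graph_def adj_in_def)
  have "(adj_in V E ^^ k) u v \<Longrightarrow> (adj_in V E ^^ k) v u" for k u v
  proof (induction k arbitrary: v)
    case (Suc k)
    then obtain w where "(adj_in V E ^^ k) u w" "adj_in V E w v" by auto
    then show ?case using Suc.IH step relpowp_Suc_I2 by metis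
  qed auto
  then have "(adj_in V E ^^ k) u v \<longleftrightarrow> (adj_in V E ^^ k) v u" for k by blast
  then show ?thesis unfolding gdist_def by simp
qed

lemma relpowp_gdist:
  assumes "connected_graph V E" "u \<in> V" "v \<in> V"
  shows "(adj_in V E ^^ gdist V E u v) u v"
proof -
  have "(adj_in V E)\<^sup>*\<^sup>* u v" using assms by (simp add: connected_graph_def)
  then obtain k where "(adj_in V E ^^ k) u v" by (auto simp: rtranclp_power)
  then show ?thesis unfolding gdist_def by (rule LeastI)
qed

lemma gdist_eq_0_iff:
  assumes "connected_graph V E" "u \<in> V" "v \<in> V"
  shows "gdist V E u v = 0 \<longleftrightarrow> u = v"
proof
  assume "gdist V E u v = 0"
  then show "u = v" using relpowp_gdist[OF assms] by simp
next
  assume "u = v"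
  then have "(adj_in V E ^^ 0) u v" by simp
  then show "gdist V E u v = 0" unfolding gdist_def using Least_le[of _ 0] by fastforce
qed

lemma adjacent_of_gdist_eq_1:
  assumes "connected_graph V E" "u \<in> V" "v \<in> V" "gdist V E u v = 1"
  shows "E u v"
proof -
  have "(adj_in V E ^^ 1) u v" using relpowp_gdist[OF assms(1-3)] assms(4) by simp
  then have "adj_in V E u v" by (simp only: relpowp_1)
  then show ?thesis by (simp add: adj_in_def)
qed

text \<open>Ensures that \<open>Max\<close> in \<open>dist_spectral_radius\<close> is taken over a
  finite non-empty set. Stated for symmetric distances so that it applies to the extremal graph
  directly from its explicit distances.\<close>

lemma spectrum_finite_nonempty:
  assumes "finite V" "V \<noteq> {}" "\<And>u v. u \<in> V \<Longrightarrow> v \<in> V \<Longrightarrow> gdist V E u v = gdist V E v u"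
  shows "finite (dist_eigenvalues V E)" "dist_eigenvalues V E \<noteq> {}"
proof -
  have sym: "real (gdist V E u v) = real (gdist V E v u)" if "u \<in> V" "v \<in> V" for u v
    using assms(3)[OF that] by simp
  show "finite (dist_eigenvalues V E)"
    unfolding dist_eigenvalues_def by (rule finite_symmetric_spectrum[OF assms(1) sym])
  obtain x \<mu> where "\<exists>v\<in>V. x v \<noteq> 0"
    "\<And>u. u \<in> V \<Longrightarrow> (\<Sum>v\<in>V. real (gdist V E u v) * x v) = \<mu> * x u"
    using rayleigh_quotient_attained[of V "\<lambda>u v. real (gdist V E u v)", OF assms(1,2) sym] by blast
  then have "\<mu> \<in> dist_eigenvalues V E" unfolding dist_eigenvalues_def by blast
  then show "dist_eigenvalues V E \<noteq> {}" by blast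
qed

lemma rayleigh_le_dist_spectral_radius:
  assumes "graph V E" "V \<noteq> {}"
  shows "(\<Sum>u\<in>V. \<Sum>v\<in>V. real (gdist V E u v) * (y u * y v))
     \<le> dist_spectral_radius V E * (\<Sum>u\<in>V. (y u)\<^sup>2)"
proof -
  have fin: "finite V" using assms by (simp add: graph_def)
  have sym: "gdist V E u v = gdist V E v u" for u v using gdist_commute[OF assms(1)] .
  obtain x \<mu> where x: "\<exists>v\<in>V. x v \<noteq> 0"
    "\<And>u. u \<in> V \<Longrightarrow> (\<Sum>v\<in>V. real (gdist V E u v) * x v) = \<mu> * x u"
    and ray: "\<And>y. (\<Sum>u\<in>V. \<Sum>v\<in>V. real (gdist V E u v) * (y u * y v)) \<le> \<mu> * (\<Sum>u\<in>V. (y u)\<^sup>2)"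
    using rayleigh_quotient_attained[of V "\<lambda>u v. real (gdist V E u v)", OF fin assms(2)
        arg_cong[OF sym, of real]] by blast
  have "\<mu> \<in> dist_eigenvalues V E" using x unfolding dist_eigenvalues_def by blast
  then have "\<mu> \<le> dist_spectral_radius V E"
    unfolding dist_spectral_radius_def using spectrum_finite_nonempty[OF fin assms(2) sym] by simp
  then show ?thesis using ray[of y] by (meson mult_right_mono order_trans sum_nonneg zero_le_power2)
qed

section \<open>Lower bound for the spectral radius from separated vertex classes\<close>

text \<open>All ordered pairs contribute the square of the total; those inside a class contribute
  the square of the class sum.\<close>

lemma sum_cross_products:
  fixes x :: "'a \<Rightarrow> real"
  assumes "finite W" "finite I" "f ` W \<subseteq> I"
  shows "(\<Sum>u\<in>W. \<Sum>v\<in>W. if f u \<noteq> f v then x u * x v else 0)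
    = (\<Sum>u\<in>W. x u)\<^sup>2 - (\<Sum>i\<in>I. (\<Sum>u\<in>{u\<in>W. f u = i}. x u)\<^sup>2)"
proof -
  have "(\<Sum>i\<in>I. (\<Sum>u\<in>{u\<in>W. f u = i}. x u)\<^sup>2)
      = (\<Sum>i\<in>I. \<Sum>u\<in>{u\<in>W. f u = i}. \<Sum>v\<in>W. if f u = f v then x u * x v else 0)"
  proof (rule sum.cong[OF refl])
    fix i
    have "(\<Sum>u\<in>{u\<in>W. f u = i}. x u)\<^sup>2
        = (\<Sum>u\<in>{u\<in>W. f u = i}. \<Sum>v\<in>{v\<in>W. f v = i}. x u * x v)"
      by (simp add: power2_eq_square sum_product)
    also have "\<dots> = (\<Sum>u\<in>{u\<in>W. f u = i}. \<Sum>v\<in>W. if f u = f v then x u * x v else 0)"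
      using assms(1) by (intro sum.cong refl sum.mono_neutral_cong_left) auto
    finally show "(\<Sum>u\<in>{u\<in>W. f u = i}. x u)\<^sup>2
        = (\<Sum>u\<in>{u\<in>W. f u = i}. \<Sum>v\<in>W. if f u = f v then x u * x v else 0)" .
  qed
  also have "\<dots> = (\<Sum>u\<in>W. \<Sum>v\<in>W. if f u = f v then x u * x v else 0)"
    by (rule sum.group[OF assms])
  finally have "(\<Sum>u\<in>W. \<Sum>v\<in>W. if f u \<noteq> f v then x u * x v else 0)
      + (\<Sum>i\<in>I. (\<Sum>u\<in>{u\<in>W. f u = i}. x u)\<^sup>2) = (\<Sum>u\<in>W. \<Sum>v\<in>W. x u * x v)"
    by (simp add: sum.distrib[symmetric] cong: if_cong) (intro sum.cong refl, auto)
  then show ?thesis by (simp add: power2_eq_square sum_product)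
qed

text \<open>Entrywise lower bound for the distance matrix that remembers only the classes of
  \<open>f\<close> on \<open>W\<close>. In the application \<open>W\<close> is the complement of a
  cut set \<open>S\<close> and no edge of \<open>W\<close> joins two classes.\<close>

definition separation_bound :: "'a set \<Rightarrow> ('a \<Rightarrow> 'b) \<Rightarrow> 'a \<Rightarrow> 'a \<Rightarrow> real" where
  "separation_bound W f u v =
     (if u = v then 0 else if u \<in> W \<and> v \<in> W \<and> f u \<noteq> f v then 2 else 1)"

text \<open>The bounding matrix is the all-ones matrix minus the identity plus the indicator of
  pairs in distinct classes; these three parts give the terms of the formula.\<close>

lemma separation_bound_form:
  fixes x :: "'a \<Rightarrow> real"
  assumes "finite V" "W \<subseteq> V" "finite I" "f ` W \<subseteq> I"
  shows "(\<Sum>u\<in>V. \<Sum>v\<in>V. separation_bound W f u v * (x u * x v))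
    = (\<Sum>u\<in>V. x u)\<^sup>2 - (\<Sum>u\<in>V. (x u)\<^sup>2) + (\<Sum>u\<in>W. x u)\<^sup>2
      - (\<Sum>i\<in>I. (\<Sum>u\<in>{u\<in>W. f u = i}. x u)\<^sup>2)"
proof -
  have fin: "finite W" using assms finite_subset by blast
  have "(\<Sum>u\<in>V. \<Sum>v\<in>V. separation_bound W f u v * (x u * x v))
     = (\<Sum>u\<in>V. \<Sum>v\<in>V. x u * x v - (if u = v then x u * x v else 0)
        + (if u \<in> W \<and> v \<in> W \<and> f u \<noteq> f v then x u * x v else 0))"
    by (intro sum.cong refl) (auto simp: separation_bound_def)
  also have "\<dots> = (\<Sum>u\<in>V. \<Sum>v\<in>V. x u * x v) - (\<Sum>u\<in>V. (x u)\<^sup>2)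
       + (\<Sum>u\<in>V. \<Sum>v\<in>V. if u \<in> W \<and> v \<in> W \<and> f u \<noteq> f v then x u * x v else 0)"
    using assms(1) by (simp add: sum.distrib sum_subtractf power2_eq_square)
  also have "(\<Sum>u\<in>V. \<Sum>v\<in>V. if u \<in> W \<and> v \<in> W \<and> f u \<noteq> f v then x u * x v else 0)
     = (\<Sum>u\<in>W. \<Sum>v\<in>V. if u \<in> W \<and> v \<in> W \<and> f u \<noteq> f v then x u * x v else 0)"
    using assms by (intro sum.mono_neutral_right) auto
  also have "\<dots> = (\<Sum>u\<in>W. \<Sum>v\<in>W. if f u \<noteq> f v then x u * x v else 0)"
    using assms by (intro sum.cong refl sum.mono_neutral_cong_right) auto
  finally show ?thesis unfolding sum_cross_products[OF fin assms(3,4)]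
    by (simp add: power2_eq_square sum_product)
qed

lemma separation_bound_le_gdist:
  assumes "connected_graph V E" "u \<in> V" "v \<in> V"
    and "\<And>u v. u \<in> W \<Longrightarrow> v \<in> W \<Longrightarrow> E u v \<Longrightarrow> f u = f v"
  shows "separation_bound W f u v \<le> real (gdist V E u v)"
proof (cases "u = v")
  case True
  then show ?thesis by (simp add: separation_bound_def)
next
  case False
  then have "gdist V E u v \<noteq> 0" using gdist_eq_0_iff[OF assms(1-3)] by simp
  moreover have "gdist V E u v \<noteq> 1" if "u \<in> W" "v \<in> W" "f u \<noteq> f v"
    using adjacent_of_gdist_eq_1[OF assms(1-3)] assms(4) that by blast
  ultimately show ?thesis by (auto simp: separation_bound_def)
qed

text \<open>Rayleigh's principle, with the distance matrix replaced by its entrywise lower bound,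
  which is legitimate for positive weights. The \<open>+ 1\<close> absorbs the subtracted identity
  matrix.\<close>

lemma dist_spectral_radius_separation:
  fixes x :: "'a \<Rightarrow> real"
  assumes G: "graph V E" "connected_graph V E"
    and W: "W \<subseteq> V" "finite I" "f ` W \<subseteq> I"
    and sep: "\<And>u v. u \<in> W \<Longrightarrow> v \<in> W \<Longrightarrow> E u v \<Longrightarrow> f u = f v"
    and pos: "\<And>u. u \<in> V \<Longrightarrow> x u > 0"
  shows "(\<Sum>u\<in>V. x u)\<^sup>2 + (\<Sum>u\<in>W. x u)\<^sup>2 - (\<Sum>i\<in>I. (\<Sum>u\<in>{u\<in>W. f u = i}. x u)\<^sup>2)
      \<le> (dist_spectral_radius V E + 1) * (\<Sum>u\<in>V. (x u)\<^sup>2)"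
    and "\<lbrakk>(\<Sum>u\<in>V. x u)\<^sup>2 + (\<Sum>u\<in>W. x u)\<^sup>2 - (\<Sum>i\<in>I. (\<Sum>u\<in>{u\<in>W. f u = i}. x u)\<^sup>2)
      = (dist_spectral_radius V E + 1) * (\<Sum>u\<in>V. (x u)\<^sup>2);
      u \<in> V; v \<in> V; u \<noteq> v; \<not> (u \<in> W \<and> v \<in> W \<and> f u \<noteq> f v)\<rbrakk> \<Longrightarrow> E u v"
proof -
  let ?L = "(\<Sum>u\<in>V. x u)\<^sup>2 + (\<Sum>u\<in>W. x u)\<^sup>2 - (\<Sum>i\<in>I. (\<Sum>u\<in>{u\<in>W. f u = i}. x u)\<^sup>2)"
  let ?R = "(dist_spectral_radius V E + 1) * (\<Sum>u\<in>V. (x u)\<^sup>2)"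
  have fin: "finite V" and ne: "V \<noteq> {}" using G by (auto simp: graph_def connected_graph_def)
  let ?D = "\<lambda>u v. real (gdist V E u v)"
  let ?B = "separation_bound W f"
  have termwise: "0 \<le> (?D u v - ?B u v) * (x u * x v)" if "u \<in> V" "v \<in> V" for u v
    using separation_bound_le_gdist[of V E u v W f] G(2) sep that pos[of u] pos[of v]
    by (intro mult_nonneg_nonneg) auto
  have form: "(\<Sum>u\<in>V. \<Sum>v\<in>V. ?B u v * (x u * x v)) = ?L - (\<Sum>u\<in>V. (x u)\<^sup>2)"
    unfolding separation_bound_form[OF fin W] by simp
  have diff: "(\<Sum>u\<in>V. \<Sum>v\<in>V. (?D u v - ?B u v) * (x u * x v))
     = (\<Sum>u\<in>V. \<Sum>v\<in>V. ?D u v * (x u * x v)) - (?L - (\<Sum>u\<in>V. (x u)\<^sup>2))"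
    unfolding form[symmetric] by (simp add: left_diff_distrib sum_subtractf)
  have nn: "0 \<le> (\<Sum>u\<in>V. \<Sum>v\<in>V. (?D u v - ?B u v) * (x u * x v))"
    by (intro sum_nonneg termwise)
  have ray: "(\<Sum>u\<in>V. \<Sum>v\<in>V. ?D u v * (x u * x v)) \<le> ?R - (\<Sum>u\<in>V. (x u)\<^sup>2)"
    using rayleigh_le_dist_spectral_radius[OF G(1) ne, of x] by (simp add: algebra_simps)
  show "?L \<le> ?R" using nn diff ray by linarith
  assume "?L = ?R" and uv: "u \<in> V" "v \<in> V" "u \<noteq> v" "\<not> (u \<in> W \<and> v \<in> W \<and> f u \<noteq> f v)"
  then have "(\<Sum>u\<in>V. \<Sum>v\<in>V. (?D u v - ?B u v) * (x u * x v)) = 0"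
    using nn diff ray by linarith
  \<comment> \<open>In the equality case a sum of nonnegative terms vanishes, so each term does. The
    weights are positive, hence every distance equals its bound, and a bound of 1 means
    adjacency.\<close>
  then have "(\<Sum>v\<in>V. (?D u v - ?B u v) * (x u * x v)) = 0"
    using uv fin termwise by (subst (asm) sum_nonneg_eq_0_iff) (auto intro: sum_nonneg)
  then have "(?D u v - ?B u v) * (x u * x v) = 0"
    using uv fin termwise by (subst (asm) sum_nonneg_eq_0_iff) auto
  then have "?D u v = ?B u v" using pos[of u] pos[of v] uv by auto
  also have "\<dots> = 1" using uv unfolding separation_bound_def by auto
  finally show "E u v" using adjacent_of_gdist_eq_1[OF G(2) uv(1,2)] by simp
qed

section \<open>The extremal graph\<close>

text \<open>The Perron vector of the extremal graph takes the values \<open>a\<close>, \<open>b\<close>, \<open>c\<close> on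
  \<open>K\<^sub>d\<close>, \<open>K\<^bsub>n-2d\<^esub>\<close>, \<open>d K\<^sub>1\<close>; it is normalised to have sum 1, and \<open>r - 1\<close> is its eigenvalue.\<close>

definition extremal_weights :: "real \<Rightarrow> real \<Rightarrow> real \<Rightarrow> real \<Rightarrow> real \<Rightarrow> real \<Rightarrow> bool" where
  "extremal_weights n d r a b c \<longleftrightarrow> r \<ge> n \<and> 0 < a \<and> a \<le> b \<and> a \<le> c \<and> c < 2 * a \<and>
     r * a = 1 \<and> r * b = 1 + d * c \<and> (r + 1) * c = 2 - d * a \<and> d * a + (n - 2 * d) * b + d * c = 1"

lemma extremal_weights_exist:
  fixes n d :: real
  assumes "d \<ge> 1" "n \<ge> 8 * d"
  shows "\<exists>r a b c. extremal_weights n d r a b c"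
proof -
  define A where "A r = 1 / r" for r :: real
  define C where "C r = (2 - d * A r) / (r + 1)" for r :: real
  define B where "B r = (1 + d * C r) / r" for r :: real
  define F where "F r = d * A r + (n - 2 * d) * B r + d * C r" for r :: real
  have props: "0 < A r" "A r \<le> B r" "A r \<le> C r" "C r < 2 * A r" "B r \<le> 2 * A r"
    if "r \<ge> n" for r
  proof -
    have r: "r \<ge> 8 * d" "r \<ge> 8" using assms that by auto
    then have r0: "r > 0" by simp
    show A0: "0 < A r" using r0 by (simp add: A_def)
    have dA: "d * A r \<le> 1/8" "0 < d * A r" using r r0 assms by (auto simp: A_def field_simps)
    show AC: "A r \<le> C r"
    proof -
      have "A r * (r + 1) = 1 + A r" using r0 by (simp add: A_def field_simps)
      also have "\<dots> \<le> 2 - d * A r"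
      proof -
        have "A r \<le> 1" using r by (simp add: A_def)
        moreover have "A r * 8 \<le> 1" using r by (simp add: A_def)
        ultimately show ?thesis using dA by linarith
      qed
      finally show ?thesis unfolding C_def using r0 by (simp add: field_simps)
    qed
    show CA: "C r < 2 * A r"
    proof -
      have "C r < 2 / (r + 1)" unfolding C_def using dA r0 by (intro divide_strict_right_mono) auto
      also have "\<dots> \<le> 2 * A r" using r0 by (simp add: A_def field_simps)
      finally show ?thesis .
    qed
    have "0 \<le> d * C r" using AC A0 assms by simp
    then show "A r \<le> B r" unfolding A_def B_def using r0 by (simp add: divide_right_mono)
    have "d * C r \<le> d * (2 * A r)" using CA assms by (intro mult_left_mono) auto
    also have "\<dots> \<le> 1" using dA by simp
    finally show "B r \<le> 2 * A r" unfolding A_def B_def using r0 by (simp add: divide_right_mono)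
  qed
  have n0: "n > 0" using assms by auto
  have low: "F n \<ge> 1"
  proof -
    have "1 = d * A n + (n - 2 * d) * A n + d * A n"
      using n0 by (simp add: A_def field_simps)
    also have "\<dots> \<le> F n" unfolding F_def
      using props[of n] assms by (intro add_mono mult_left_mono) auto
    finally show ?thesis .
  qed
  have high: "F (4 * n) \<le> 1"
  proof -
    have "F (4 * n) \<le> d * (2 * A (4 * n)) + (n - 2 * d) * (2 * A (4 * n)) + d * (2 * A (4 * n))"
      unfolding F_def using props[of "4 * n"] assms by (intro add_mono mult_left_mono) auto
    also have "\<dots> = 1/2" using n0 by (simp add: A_def field_simps)
    finally show ?thesis by simp
  qed
  have "continuous_on {n..4*n} F" unfolding F_def B_def C_def A_def
    using n0 by (intro continuous_intros) auto
  then obtain r where r: "n \<le> r" "F r = 1"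
    using IVT2'[of F "4 * n" 1 n] low high n0 by auto
  have "extremal_weights n d r (A r) (B r) (C r)"
    unfolding extremal_weights_def using props[OF r(1)] r n0 by (auto simp: A_def B_def C_def F_def)
  then show ?thesis by blast
qed

text \<open>The diameter is at most 2, since \<open>0 < d\<close> makes vertex 0 a member of the
  dominating clique.\<close>

lemma extremal_gdist:
  assumes "0 < d" "u < n" "v < n"
  shows "gdist (extremal_vertices n) (extremal_adj n d) u v =
    (if u = v then 0 else if extremal_adj n d u v then 1 else 2)"
proof -
  let ?R = "adj_in (extremal_vertices n) (extremal_adj n d)"
  have R: "?R u v \<longleftrightarrow> extremal_adj n d u v" for u v
    by (auto simp: adj_in_def extremal_vertices_def extremal_adj_def)
  have 0: "(?R ^^ 0) u v \<longleftrightarrow> u = v" by simp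
  have 1: "(?R ^^ 1) u v \<longleftrightarrow> extremal_adj n d u v" unfolding relpowp_1 R ..
  consider "u = v" | "u \<noteq> v" "extremal_adj n d u v" | "u \<noteq> v" "\<not> extremal_adj n d u v" by blast
  then show ?thesis
  proof cases
    case 1
    then show ?thesis unfolding gdist_def by (auto intro: Least_equality)
  next
    case 2
    have "(LEAST k. (?R ^^ k) u v) = 1"
    proof (rule Least_equality)
      show "(?R ^^ 1) u v" using 1 2 by blast
      fix k assume "(?R ^^ k) u v"
      then have "k \<noteq> 0" using 2 by (metis 0)
      then show "1 \<le> k" by simp
    qed
    then show ?thesis using 2 by (simp add: gdist_def)
  next
    case 3
    have "(LEAST k. (?R ^^ k) u v) = 2"
    proof (rule Least_equality)
      have "extremal_adj n d u 0" "extremal_adj n d 0 v"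
        using 3 assms by (auto simp: extremal_adj_def)
      then have "(?R OO ?R) u v" using R by blast
      then show "(?R ^^ 2) u v" by (simp add: numeral_2_eq_2 relcompp_apply) 
      fix k assume k: "(?R ^^ k) u v"
      have "k \<noteq> 0" "k \<noteq> 1" using 3 k 0 1 by metis+
      then show "2 \<le> k" by simp
    qed
    then show ?thesis using 3 by (simp add: gdist_def)
  qed
qed

text \<open>The weights form a positive eigenvector for \<open>r - 1\<close>, which therefore bounds
  every eigenvalue. This direction turns the hypothesis on the spectral radii into a bound by
  \<open>r\<close>.\<close>

lemma extremal_dist_spectral_radius_le:
  assumes "extremal_weights (real n) (real d) r a b c" "0 < d" "2 * d < n"
  shows "dist_spectral_radius (extremal_vertices n) (extremal_adj n d) \<le> r - 1"
proof -
  let ?V = "extremal_vertices n" let ?E = "extremal_adj n d"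
  have V: "finite ?V" "?V \<noteq> {}" using assms by (auto simp: extremal_vertices_def)
  define z where "z u = (if u < d then a else if u < n - d then b else c)" for u
  have pos: "0 < a" "0 < b" "0 < c" using assms(1) by (auto simp: extremal_weights_def)
  have sym: "gdist ?V ?E u v = gdist ?V ?E v u" if "u \<in> ?V" "v \<in> ?V" for u v
  proof -
    have "u < n" "v < n" using that by (auto simp: extremal_vertices_def)
    then show ?thesis unfolding extremal_gdist[OF assms(2) \<open>u < n\<close> \<open>v < n\<close>]
      extremal_gdist[OF assms(2) \<open>v < n\<close> \<open>u < n\<close>] by (auto simp: extremal_adj_def)
  qed
  have s1: "(\<Sum>v\<in>{0..<d}. z v) = d * a" by (simp add: z_def)
  have s2: "(\<Sum>v\<in>{d..<n-d}. z v) = (real n - 2 * d) * b"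
    using assms(3) by (simp add: z_def)
  have s3: "(\<Sum>v\<in>{n-d..<n}. z v) = d * c"
  proof -
    have "(\<Sum>v\<in>{n-d..<n}. z v) = (\<Sum>v\<in>{n-d..<n}. c)"
      using assms(3) by (intro sum.cong) (auto simp: z_def)
    then show ?thesis using assms(3) by simp
  qed
  have tail: "(\<Sum>v\<in>{d..<n}. z v) = (real n - 2 * d) * b + d * c"
  proof -
    have "{d..<n} = {d..<n-d} \<union> {n-d..<n}" using assms by auto
    then show ?thesis using s2 s3 by (simp add: sum.union_disjoint)
  qed
  have total: "(\<Sum>v\<in>?V. z v) = 1"
  proof -
    have "?V = {0..<d} \<union> {d..<n}" using assms by (auto simp: extremal_vertices_def)
    then show ?thesis using s1 tail assms(1) by (simp add: sum.union_disjoint extremal_weights_def)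
  qed
  have eig: "(\<Sum>v\<in>?V. real (gdist ?V ?E u v) * z v) = (r - 1) * z u" if u: "u \<in> ?V" for u
  proof -
    \<comment> \<open>The vertices at distance 2 from \<open>u\<close>. As the total weight is 1,
      row \<open>u\<close> of the product is \<open>1 - z u\<close> plus the weight of
      \<open>N\<close>; the three positions of \<open>u\<close> give the three equations for
      \<open>a\<close>, \<open>b\<close>, \<open>c\<close>.\<close>
    define N where "N = {v \<in> ?V. v \<noteq> u \<and> \<not> ?E u v}"
    have un: "u < n" using u by (simp add: extremal_vertices_def)
    have "(\<Sum>v\<in>?V. real (gdist ?V ?E u v) * z v)
      = (\<Sum>v\<in>?V. z v - (if u = v then z v else 0) + (if v \<in> N then z v else 0))"
    proof (intro sum.cong refl)
      fix v assume v: "v \<in> ?V"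
      then have "v < n" by (simp add: extremal_vertices_def)
      have "\<not> ?E u u" by (simp add: extremal_adj_def)
      then show "real (gdist ?V ?E u v) * z v
          = z v - (if u = v then z v else 0) + (if v \<in> N then z v else 0)"
        unfolding extremal_gdist[OF assms(2) un \<open>v < n\<close>] N_def using v by auto
    qed
    also have "\<dots> = 1 - z u + (\<Sum>v\<in>?V \<inter> N. z v)"
      using V u total by (simp add: sum.distrib sum_subtractf sum.inter_restrict)
    also have "?V \<inter> N = N" by (auto simp: N_def)
    finally have eq: "(\<Sum>v\<in>?V. real (gdist ?V ?E u v) * z v) = 1 - z u + (\<Sum>v\<in>N. z v)" .
    consider "u < d" | "d \<le> u" "u < n - d" | "n - d \<le> u" by linarith
    then show ?thesis
    proof cases
      case 1
      then have "N = {}" using un by (auto simp: N_def extremal_vertices_def extremal_adj_def)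
      then show ?thesis using eq 1 assms(1) by (simp add: z_def extremal_weights_def algebra_simps)
    next
      case 2
      then have "N = {n-d..<n}" using un by (auto simp: N_def extremal_vertices_def extremal_adj_def)
      then show ?thesis using eq 2 s3 assms(1) by (simp add: z_def extremal_weights_def algebra_simps)
    next
      case 3
      then have N: "N = {d..<n} - {u}" using un assms(3) by (auto simp: N_def extremal_vertices_def extremal_adj_def)
      have "(\<Sum>v\<in>N. z v) = (real n - 2 * d) * b + d * c - z u"
        using tail 3 un assms(3) by (subst N, subst sum_diff1) auto
      moreover have "z u = c" using 3 assms(3) by (auto simp: z_def)
      ultimately show ?thesis using eq assms(1) by (simp add: extremal_weights_def algebra_simps)
    qed
  qed
  have "\<mu> \<le> r - 1" if "\<mu> \<in> dist_eigenvalues ?V ?E" for \<mu>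
  proof -
    from that obtain y :: "nat \<Rightarrow> real" and w where y: "w \<in> ?V" "y w \<noteq> 0"
      "\<And>u. u \<in> ?V \<Longrightarrow> (\<Sum>v\<in>?V. real (gdist ?V ?E u v) * y v) = \<mu> * y u"
      unfolding dist_eigenvalues_def by blast
    show ?thesis
      by (rule eigenvalue_le_of_positive_eigenvector[where M = "\<lambda>u v. real (gdist ?V ?E u v)"
            and z = z and y = y and w = w and V = ?V])
        (use V sym eig y pos in \<open>auto simp: z_def\<close>)
  qed
  then show ?thesis unfolding dist_spectral_radius_def
    using spectrum_finite_nonempty[of ?V ?E] V sym by simp
qed

section \<open>Norm of the Perron vector and size of the extremal eigenvalue\<close>

text \<open>The quadratic form of distance matrix plus identity at the Perron vector: the squared
  total weight 1, plus the weight products over ordered pairs at distance 2. Hence for any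
  rearrangement of these weights only the sums over separated pairs have to be compared.\<close>

lemma extremal_weights_norm:
  assumes "extremal_weights n d r a b c"
  shows "r * (d * a\<^sup>2 + (n - 2 * d) * b\<^sup>2 + d * c\<^sup>2)
    = 1 + d * (d - 1) * c\<^sup>2 + 2 * d * (n - 2 * d) * (b * c)"
proof -
  define m where "m = n - 2 * d"
  have w: "r * a = 1" "r * b = 1 + d * c" "(r + 1) * c = 2 - d * a" "d * a + m * b + d * c = 1"
    using assms by (auto simp: extremal_weights_def m_def)
  have "r * (d * a\<^sup>2 + m * b\<^sup>2 + d * c\<^sup>2)
      = d * a * (r * a) + m * b * (r * b) + d * c * ((r + 1) * c) - d * c\<^sup>2"
    by (simp add: power2_eq_square algebra_simps)
  also have "\<dots> = (d * a + m * b + d * c) + m * b * (d * c) + d * c * (1 - d * a) - d * c\<^sup>2"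
    unfolding w(1-3) by (simp add: algebra_simps)
  also have "1 - d * a = m * b + d * c" using w(4) by simp
  finally show ?thesis unfolding w(4) m_def[symmetric]
    by (simp add: power2_eq_square algebra_simps)
qed

text \<open>Eliminating the weights leaves
  \<open>r * r \<le> (n + d) * r + 2 * d * (n - 2 * d)\<close>. For \<open>d \<le> n / 8\<close>
  this is at most \<open>9/8 * n * r + 3/16 * n * n\<close>, and the positive root of the limiting
  quadratic is about \<open>1.2724 * n\<close>.\<close>

lemma extremal_weights_eigenvalue_less:
  assumes w: "extremal_weights n d r a b c" and d: "1 \<le> d" "8 * d \<le> n"
  shows "r < 1273/1000 * n"
proof -
  have w: "n \<le> r" "0 < a" "a \<le> b" "r * a = 1" "r * b = 1 + d * c" "(r + 1) * c = 2 - d * a"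
    "d * a + (n - 2 * d) * b + d * c = 1" "a \<le> c"
    using w by (auto simp: extremal_weights_def)
  have pos: "0 < b" "0 \<le> r" "0 < n" using w d by auto
  have da: "d * a \<le> d * b" using w d by (intro mult_left_mono) auto
  have "r * b = d * a + (n - 2 * d) * b + 2 * (d * c)" using w(5,7) by linarith
  also have "\<dots> \<le> (n - d) * b + 2 * d * c" using da by (simp add: algebra_simps)
  finally have "r * (r * b) \<le> r * ((n - d) * b + 2 * d * c)"
    using pos by (intro mult_left_mono) auto
  also have "\<dots> = (n - d) * r * b + 2 * d * (r * c)" by (simp add: algebra_simps)
  also have "\<dots> \<le> (n - d) * r * b + 2 * d * (r * b + (n - 2 * d) * b)"
  proof -
    have "r * c \<le> (r + 1) * c" using w by (simp add: algebra_simps)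
    also have "\<dots> = r * b + (n - 2 * d) * b" unfolding w(6) using w(5,7) by linarith
    finally show ?thesis using d by (intro add_left_mono mult_left_mono) auto
  qed
  also have "\<dots> = ((n + d) * r + 2 * d * (n - 2 * d)) * b" by (simp add: algebra_simps)
  finally have q: "r * r \<le> (n + d) * r + 2 * d * (n - 2 * d)" using pos by (simp add: mult.assoc[symmetric])
  have dr: "(n + d) * r \<le> (9/8 * n) * r" using d pos by (intro mult_right_mono) auto
  have dd: "2 * d * (n - 2 * d) \<le> 3/16 * (n * n)"
  proof -
    have "0 \<le> (n - 8 * d) * (3 * n - 8 * d)" using d by (intro mult_nonneg_nonneg) auto
    then show ?thesis by (simp add: algebra_simps)
  qed
  show ?thesis
  proof (rule ccontr)
    assume "\<not> ?thesis"
    then have r: "r \<ge> 1273/1000 * n" by simp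
    \<comment> \<open>Here 148/1000 is 1273/1000 - 9/8, and the product 0.188404 just exceeds 3/16 =
      0.1875.\<close>
    then have "(1273/1000 * n) * (148/1000 * n) \<le> r * (r - 9/8 * n)"
      using pos by (intro mult_mono) auto
    then have "188404/1000000 * (n * n) \<le> 3/16 * (n * n)" using q dr dd by (simp add: algebra_simps)
    then show False using pos by (simp add: zero_less_mult_iff)
  qed
qed

section \<open>Weight inequalities\<close>

text \<open>In the next three lemmas \<open>\<alpha>\<close> and \<open>m\<close>, \<open>Y\<close> count the vertices of weight \<open>b\<close> in the
  largest part and the surplus of such vertices in the other parts; \<open>Z\<close> is a sum of squares of
  surpluses.\<close>

lemma small_cut_gain:
  fixes a b c d s \<alpha> m Y Z :: real
  assumes s: "1 \<le> s" "s + 1 \<le> d"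
    and w: "0 < a" "a \<le> b" "a \<le> c" "c < 2 * a"
    and p: "1 \<le> \<alpha>" "0 \<le> m" "0 \<le> Y" "Z \<le> Y\<^sup>2"
    and big: "m > 0 \<Longrightarrow> 2 * (d - s + 1) \<le> \<alpha> + (d - s) + Y"
  shows "d * (d - 1) * c\<^sup>2 + 2 * d * (\<alpha> + m + Y) * (b * c)
    < ((d - s) * a + \<alpha> * b + ((d - s + 1) * c + m * b) + ((s - 1) * c + Y * b))\<^sup>2
      - ((d - s) * a + \<alpha> * b)\<^sup>2 - ((d - s + 1) * c + m * b)\<^sup>2
      - ((s - 1) * c\<^sup>2 + 2 * c * b * Y + b\<^sup>2 * Z)" (is "?L < ?R")
proof -
  define k where "k = d - s"
  have k: "1 \<le> k" using s by (simp add: k_def)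
  have d: "d = s + k" by (simp add: k_def)
  \<comment> \<open>The gain splits into four groups. The first is positive because
    \<open>c < 2 * a\<close> and \<open>k + 1 \<le> d\<close>; the others are nonnegative, the one
    with factor \<open>m\<close> because \<open>big\<close> makes the largest part heavy
    enough.\<close>
  have id: "?R - ?L = k * c * (2 * a * d - (k + 1) * c) + 2 * b * Y * (\<alpha> * b + k * a - c)
      + 2 * b * m * (\<alpha> * b + k * a + b * Y - (k + 1) * c) + b\<^sup>2 * (Y\<^sup>2 - Z)"
    unfolding k_def[symmetric] unfolding d by (simp add: power2_eq_square algebra_simps)
  have t1: "0 < k * c * (2 * a * d - (k + 1) * c)"
  proof -
    have "(k + 1) * c < (k + 1) * (2 * a)" using k w by (intro mult_strict_left_mono) auto
    also have "\<dots> \<le> d * (2 * a)" using s d w by (intro mult_right_mono) auto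
    finally show ?thesis using k w by (intro mult_pos_pos) (auto simp: mult_ac)
  qed
  have ka: "a \<le> k * a" using k w mult_right_mono[of 1 k a] by simp
  have ab: "b \<le> \<alpha> * b" using p w mult_right_mono[of 1 \<alpha> b] by simp
  have "0 \<le> \<alpha> * b + k * a - c" using w ka ab by linarith
  then have t2: "0 \<le> 2 * b * Y * (\<alpha> * b + k * a - c)"
    using p w by (intro mult_nonneg_nonneg) auto
  have t3: "0 \<le> 2 * b * m * (\<alpha> * b + k * a + b * Y - (k + 1) * c)"
  proof (cases "m > 0")
    case True
    have "(k + 1) * c \<le> (k + 1) * (2 * a)" using k w by (intro mult_left_mono) auto
    also have "\<dots> \<le> (\<alpha> + k + Y) * a"
      using big[OF True] w mult_right_mono[of "2 * (k + 1)" "\<alpha> + k + Y" a]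
      by (simp add: k_def mult_ac)
    also have "\<dots> \<le> \<alpha> * b + k * a + b * Y"
    proof -
      have "\<alpha> * a \<le> \<alpha> * b" "Y * a \<le> Y * b" using w p by (auto intro: mult_left_mono)
      then show ?thesis by (simp add: distrib_right mult.commute[of b Y])
    qed
    finally show ?thesis using p w by (intro mult_nonneg_nonneg) auto
  next
    case False
    then show ?thesis using p by simp
  qed
  have t4: "0 \<le> b\<^sup>2 * (Y\<^sup>2 - Z)" using p by simp
  show ?thesis using id t1 t2 t3 t4 by linarith
qed

lemma large_cut_gain:
  fixes b c d k \<alpha> Y1 Y2 Z1 Z2 :: real
  assumes k: "0 \<le> k" "k = 0 \<or> 1 \<le> k \<and> 2 * d \<le> \<alpha> + Y1 + Y2" and d: "0 < d"
    and w: "0 < b" "0 < c" "c < 2 * b"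
    and p: "1 \<le> \<alpha>" "0 \<le> Y1" "0 \<le> Y2" "Z1 \<le> Y1\<^sup>2" "Z2 \<le> Y2\<^sup>2" "Y1 + Y2 > 0 \<Longrightarrow> 2 \<le> \<alpha>"
  shows "d * (d - 1) * c\<^sup>2 + 2 * d * (2 * k + \<alpha> + Y1 + Y2) * (b * c)
    \<le> (\<alpha> * b + (d * c + Y1 * b) + (k * b + Y2 * b))\<^sup>2 - (\<alpha> * b)\<^sup>2
      - (d * c\<^sup>2 + 2 * c * b * Y1 + b\<^sup>2 * Z1) - b\<^sup>2 * (k + 2 * Y2 + Z2)" (is "?L \<le> ?R")
    and "k > 0 \<or> Y1 + Y2 > 0 \<Longrightarrow> d * (d - 1) * c\<^sup>2 + 2 * d * (2 * k + \<alpha> + Y1 + Y2) * (b * c)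
    < (\<alpha> * b + (d * c + Y1 * b) + (k * b + Y2 * b))\<^sup>2 - (\<alpha> * b)\<^sup>2
      - (d * c\<^sup>2 + 2 * c * b * Y1 + b\<^sup>2 * Z1) - b\<^sup>2 * (k + 2 * Y2 + Z2)"
proof -
  let ?L = "d * (d - 1) * c\<^sup>2 + 2 * d * (2 * k + \<alpha> + Y1 + Y2) * (b * c)"
  let ?R = "(\<alpha> * b + (d * c + Y1 * b) + (k * b + Y2 * b))\<^sup>2 - (\<alpha> * b)\<^sup>2
      - (d * c\<^sup>2 + 2 * c * b * Y1 + b\<^sup>2 * Z1) - b\<^sup>2 * (k + 2 * Y2 + Z2)"
  \<comment> \<open>Here \<open>k\<close> is the excess of the cut size over \<open>d\<close>. The
    group with factor \<open>k\<close> is positive for \<open>k \<ge> 1\<close> because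
    \<open>c < 2 * b\<close>; the groups linear in \<open>Y1\<close> and \<open>Y2\<close> are
    positive as soon as a surplus exists, since then \<open>\<alpha> \<ge> 2\<close>. This yields
    the strict version.\<close>
  have id: "?R - ?L = b * (k * (b * (k - 1) + 2 * (b * (\<alpha> + Y1 + Y2) - c * d))
      + 2 * Y1 * (\<alpha> * b - c) + 2 * Y2 * b * (\<alpha> - 1) + 2 * b * Y1 * Y2
      + b * (Y1\<^sup>2 - Z1) + b * (Y2\<^sup>2 - Z2))"
    by (simp add: power2_eq_square algebra_simps)
  have t1: "0 \<le> k * (b * (k - 1) + 2 * (b * (\<alpha> + Y1 + Y2) - c * d))
     \<and> (k > 0 \<longrightarrow> 0 < k * (b * (k - 1) + 2 * (b * (\<alpha> + Y1 + Y2) - c * d)))"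
  proof (cases "k = 0")
    case False
    then have k1: "1 \<le> k" "2 * d \<le> \<alpha> + Y1 + Y2" using k by auto
    have "c * d < 2 * b * d" using w d by (intro mult_strict_right_mono) auto
    also have "\<dots> \<le> b * (\<alpha> + Y1 + Y2)" using k1 w mult_left_mono[of "2 * d" "\<alpha> + Y1 + Y2" b] by (simp add: mult_ac)
    finally have "0 < b * (\<alpha> + Y1 + Y2) - c * d" by simp
    then have "0 < k * (b * (k - 1) + 2 * (b * (\<alpha> + Y1 + Y2) - c * d))"
      using k1 w by (intro mult_pos_pos add_nonneg_pos mult_nonneg_nonneg) auto
    then show ?thesis by simp
  qed simp
  have t2: "0 \<le> 2 * Y1 * (\<alpha> * b - c) + 2 * Y2 * b * (\<alpha> - 1)
     \<and> (Y1 + Y2 > 0 \<longrightarrow> 0 < 2 * Y1 * (\<alpha> * b - c) + 2 * Y2 * b * (\<alpha> - 1))"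
  proof (cases "Y1 + Y2 > 0")
    case True
    then have "2 \<le> \<alpha>" by (rule p)
    then have "2 * b \<le> \<alpha> * b" using w by (intro mult_right_mono) auto
    then have "0 < \<alpha> * b - c" using w by linarith
    moreover have "0 < b * (\<alpha> - 1)" using w \<open>2 \<le> \<alpha>\<close> by simp
    ultimately have "0 \<le> Y1 * (\<alpha> * b - c)" "Y1 > 0 \<Longrightarrow> 0 < Y1 * (\<alpha> * b - c)"
      "0 \<le> Y2 * (b * (\<alpha> - 1))" "Y2 > 0 \<Longrightarrow> 0 < Y2 * (b * (\<alpha> - 1))"
      using p by simp_all
    moreover have "Y1 > 0 \<or> Y2 > 0" using True by linarith
    ultimately have "0 < Y1 * (\<alpha> * b - c) + Y2 * (b * (\<alpha> - 1))" by linarith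
    then show ?thesis by (simp add: mult.assoc)
  next
    case False
    then have "Y1 = 0" "Y2 = 0" using p by auto
    then show ?thesis by simp
  qed
  have t3: "0 \<le> 2 * b * Y1 * Y2 + b * (Y1\<^sup>2 - Z1) + b * (Y2\<^sup>2 - Z2)"
    using w p by (intro add_nonneg_nonneg mult_nonneg_nonneg) auto
  have "0 \<le> ?R - ?L" unfolding id using w t1 t2 t3 by (intro mult_nonneg_nonneg) linarith+
  then show "?L \<le> ?R" by simp
  assume "k > 0 \<or> Y1 + Y2 > 0"
  then have "0 < ?R - ?L" unfolding id using w t1 t2 t3 by (intro mult_pos_pos) linarith+
  then show "?L < ?R" by simp
qed

lemma very_large_cut_gain:
  fixes s \<alpha> Y Z r :: real
  assumes s: "6 < s" and p: "1 \<le> \<alpha>" "0 \<le> Y" "Z \<le> Y\<^sup>2" "Y > 0 \<Longrightarrow> 2 \<le> \<alpha>" "\<alpha> + Y \<le> s"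
    and r: "r < 1273/1000 * (2 * s + \<alpha> + Y)"
  shows "r * (s + \<alpha> + (9/4 * s + Y))
    < (s + \<alpha> + (3/2 * s + Y))\<^sup>2 + (\<alpha> + (3/2 * s + Y))\<^sup>2 - \<alpha>\<^sup>2 - (9/4 * s + 3 * Y + Z)"
proof -
  define \<nu> where "\<nu> = \<alpha> + Y"
  have \<nu>: "1 \<le> \<nu>" "\<nu> \<le> s" using p by (auto simp: \<nu>_def)
  \<comment> \<open>Moving the whole surplus into the largest part can only lower the right-hand
    side, so the claim reduces to the single quantity \<open>\<nu>\<close>.\<close>
  have Y: "0 \<le> Y * (2 * \<alpha> - 3)"
  proof (cases "Y > 0")
    case True then show ?thesis using p by (intro mult_nonneg_nonneg) auto
  next
    case False then show ?thesis using p by simp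
  qed
  have "r * (13/4 * s + \<nu>) \<le> 1273/1000 * (2 * s + \<nu>) * (13/4 * s + \<nu>)"
    using r s \<nu> by (intro mult_right_mono) (auto simp: \<nu>_def)
  also have "\<dots> < (5/2 * s + \<nu>)\<^sup>2 + (3/2 * s + \<nu>)\<^sup>2 - \<nu>\<^sup>2 - 9/4 * s"
  proof -
    \<comment> \<open>These three inequalities make the comparison linear in the monomials;
      \<open>6 < s\<close> lets the quadratic surplus outweigh the term
      \<open>9/4 * s\<close>.\<close>
    have "\<nu> * \<nu> \<le> s * \<nu>" "s * 1 \<le> s * \<nu>" "6 * s < s * s"
      using \<nu> s by (auto intro: mult_right_mono mult_left_mono mult_strict_right_mono)
    moreover have "1273/1000 * (2 * s + \<nu>) * (13/4 * s + \<nu>)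
        = 82745/10000 * (s * s) + 668325/100000 * (s * \<nu>) + 1273/1000 * (\<nu> * \<nu>)"
      by (simp add: field_simps)
    moreover have "(5/2 * s + \<nu>)\<^sup>2 + (3/2 * s + \<nu>)\<^sup>2 - \<nu>\<^sup>2 - 9/4 * s
        = 17/2 * (s * s) + 8 * (s * \<nu>) + \<nu> * \<nu> - 9/4 * s"
      by (simp add: power2_eq_square field_simps)
    ultimately show ?thesis using s by linarith
  qed
  also have "\<dots> \<le> (5/2 * s + \<nu>)\<^sup>2 + (3/2 * s + \<nu>)\<^sup>2 - \<alpha>\<^sup>2 - (9/4 * s + 3 * Y + Z)"
    using Y p(3) by (simp add: \<nu>_def power2_eq_square algebra_simps)
  finally show ?thesis by (simp add: \<nu>_def algebra_simps)
qed

section \<open>Weights with prescribed multiplicities on the classes\<close>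

lemma sum_power2_le_power2_sum:
  fixes g :: "'b \<Rightarrow> real"
  assumes "finite J" "\<And>i. i \<in> J \<Longrightarrow> 0 \<le> g i"
  shows "(\<Sum>i\<in>J. (g i)\<^sup>2) \<le> (\<Sum>i\<in>J. g i)\<^sup>2"
proof -
  have "(\<Sum>i\<in>J. (g i)\<^sup>2) \<le> (\<Sum>i\<in>J. g i * (\<Sum>j\<in>J. g j))"
    unfolding power2_eq_square using assms by (intro sum_mono mult_left_mono member_le_sum) auto
  then show ?thesis by (simp add: power2_eq_square sum_distrib_right)
qed

text \<open>Choose disjoint subsets of each class for the values \<open>a\<close> and
  \<open>c\<close>, and give \<open>b\<close> to the rest. The arbitrary \<open>h\<close> covers the
  class sums of \<open>x\<close> and of its square at once.\<close>

lemma three_valued_function: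
  fixes a b c :: real
  assumes fin: "finite V" and le: "\<And>i. i \<in> I \<Longrightarrow> na i + nc i \<le> card {u \<in> V. f u = i}"
  shows "\<exists>x. (\<forall>u. x u \<in> {a, b, c}) \<and>
    (\<forall>i\<in>I. \<forall>h :: real \<Rightarrow> real. (\<Sum>u\<in>{u \<in> V. f u = i}. h (x u))
       = real (na i) * h a + real (nc i) * h c + real (card {u \<in> V. f u = i} - na i - nc i) * h b)"
proof -
  have "\<forall>i\<in>I. \<exists>q. fst q \<subseteq> {u \<in> V. f u = i} \<and> snd q \<subseteq> {u \<in> V. f u = i} - fst q
      \<and> card (fst q) = na i \<and> card (snd q) = nc i"
  proof
    fix i assume i: "i \<in> I"
    have fi: "finite {u \<in> V. f u = i}" using fin by simp
    obtain A where A: "A \<subseteq> {u \<in> V. f u = i}" "card A = na i"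
      using obtain_subset_with_card_n[of "na i" "{u \<in> V. f u = i}"] le[OF i] by auto
    then have "nc i \<le> card ({u \<in> V. f u = i} - A)"
      using le[OF i] fi by (simp add: card_Diff_subset finite_subset[OF A(1) fi])
    then obtain C where C: "C \<subseteq> {u \<in> V. f u = i} - A" "card C = nc i"
      using obtain_subset_with_card_n[of "nc i" "{u \<in> V. f u = i} - A"] by blast
    show "\<exists>q. fst q \<subseteq> {u \<in> V. f u = i} \<and> snd q \<subseteq> {u \<in> V. f u = i} - fst q
      \<and> card (fst q) = na i \<and> card (snd q) = nc i"
      by (rule exI[of _ "(A, C)"]) (simp only: fst_conv snd_conv A C simp_thms)
  qed
  from bchoice[OF this] obtain g where
    g: "\<forall>i\<in>I. fst (g i) \<subseteq> {u \<in> V. f u = i} \<and> snd (g i) \<subseteq> {u \<in> V. f u = i} - fst (g i)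
      \<and> card (fst (g i)) = na i \<and> card (snd (g i)) = nc i" by blast
  define A C where "A i = fst (g i)" and "C i = snd (g i)" for i
  have AC: "A i \<subseteq> {u \<in> V. f u = i}" "C i \<subseteq> {u \<in> V. f u = i} - A i"
    "card (A i) = na i" "card (C i) = nc i" if "i \<in> I" for i
    using g that unfolding A_def C_def by blast+
  define x where "x u = (if u \<in> A (f u) then a else if u \<in> C (f u) then c else b)" for u
  show ?thesis
  proof (intro exI[of _ x] conjI ballI allI)
    show "x u \<in> {a, b, c}" for u by (simp add: x_def)
    fix i and h :: "real \<Rightarrow> real" assume i: "i \<in> I"
    let ?P = "{u \<in> V. f u = i}"
    have fP: "finite ?P" using fin by simp
    have fAC: "finite (A i)" "finite (C i)" using AC(1,2)[OF i] fP finite_subset by blast+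
    have "(\<Sum>u\<in>?P. h (x u)) = (\<Sum>u\<in>A i. h (x u)) + ((\<Sum>u\<in>C i. h (x u)) + (\<Sum>u\<in>?P - A i - C i. h (x u)))"
      using sum.subset_diff[OF AC(1)[OF i] fP, of "\<lambda>u. h (x u)"]
        sum.subset_diff[OF AC(2)[OF i] finite_Diff[OF fP], of "\<lambda>u. h (x u)"] by simp
    also have "(\<Sum>u\<in>A i. h (x u)) = (\<Sum>u\<in>A i. h a)"
      using AC(1)[OF i] by (intro sum.cong) (auto simp: x_def)
    also have "(\<Sum>u\<in>C i. h (x u)) = (\<Sum>u\<in>C i. h c)"
      using AC(2)[OF i] by (intro sum.cong) (auto simp: x_def)
    also have "(\<Sum>u\<in>?P - A i - C i. h (x u)) = (\<Sum>u\<in>?P - A i - C i. h b)"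
      by (intro sum.cong) (auto simp: x_def)
    also have "(\<Sum>u\<in>?P - A i - C i. h b) = real (card ?P - na i - nc i) * h b"
      using AC(1,2)[OF i] fAC AC(3,4)[OF i] by (simp add: card_Diff_subset)
    finally show "(\<Sum>u\<in>?P. h (x u))
       = real (na i) * h a + real (nc i) * h c + real (card ?P - na i - nc i) * h b"
      using AC(3,4)[OF i] by simp
  qed
qed

section \<open>Graphs that are not 1-tough\<close>

text \<open>The minimum defining toughness is attained: in a non-complete graph, deleting everything
  but two non-adjacent vertices is a vertex cut, so the set of ratios is non-empty. A minimiser
  \<open>S\<close> is itself non-empty because the graph is connected.\<close>

lemma exists_violating_cut:
  assumes G: "graph V E" "connected_graph V E" and nt: "\<not> tough V E 1"
  obtains S where "S \<subseteq> V" "1 \<le> card S" "card S < num_components (V - S) E"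
proof -
  have fin: "finite V" using G by (simp add: graph_def)
  let ?T = "{real (card S) / real (num_components (V - S) E) | S. vertex_cut V E S}"
  from nt have nc: "\<not> complete_graph V E" and t: "toughness V E < 1" by (auto simp: tough_def)
  then obtain u v where uv: "u \<in> V" "v \<in> V" "u \<noteq> v" "\<not> E u v" by (auto simp: complete_graph_def)
  have no: "\<not> adj_in {u, v} E w w'" for w w'
    using uv G by (auto simp: adj_in_def graph_def)
  have star: "(adj_in {u, v} E)\<^sup>*\<^sup>* w w' \<Longrightarrow> w = w'" for w w'
    by (erule converse_rtranclpE) (use no in auto)
  have comps: "Defs.components {u, v} E = {{u}, {v}}"
    unfolding Defs.components_def using star by (auto dest: star)
  have "num_components {u, v} E = 2" unfolding num_components_def comps using uv by simp
  moreover have "V - (V - {u, v}) = {u, v}" using uv by auto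
  ultimately have "vertex_cut V E (V - {u, v})" by (auto simp: vertex_cut_def)
  then have "?T \<noteq> {}" by blast
  moreover have "finite ?T"
  proof -
    have "?T \<subseteq> (\<lambda>S. real (card S) / real (num_components (V - S) E)) ` Pow V"
      by (auto simp: vertex_cut_def)
    then show ?thesis using fin finite_subset by blast
  qed
  ultimately have "Min ?T \<in> ?T" by (rule Min_in[rotated])
  then have "toughness V E \<in> ?T" by (simp add: toughness_def)
  then obtain S where S: "vertex_cut V E S"
    "toughness V E = real (card S) / real (num_components (V - S) E)" by blast
  have c2: "2 \<le> num_components (V - S) E" and SV: "S \<subseteq> V" using S by (auto simp: vertex_cut_def)
  have lt: "card S < num_components (V - S) E" using t S(2) c2 by (simp add: divide_simps split: if_splits)
  have "S \<noteq> {}"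
  proof
    assume "S = {}"
    have "Defs.components V E \<subseteq> {V}"
      using G(2) by (auto simp: Defs.components_def connected_graph_def)
    then have "num_components V E \<le> 1" unfolding num_components_def
      using card_mono[of "{V}"] by fastforce
    then show False using c2 \<open>S = {}\<close> by simp
  qed
  then have "1 \<le> card S" using SV fin by (simp add: Suc_le_eq card_gt_0_iff finite_subset)
  then show thesis using that SV lt by blast
qed

text \<open>The values \<open>0\<close>, ..., \<open>s\<close> of \<open>f\<close> name the parts of
  \<open>V - S\<close>, each a union of components, with part 0 a largest one. The extra value
  \<open>Suc s\<close> on \<open>S\<close> makes \<open>f\<close> partition all of
  \<open>V\<close>.\<close>

locale separated_graph =
  fixes V :: "'a set" and E :: "'a \<Rightarrow> 'a \<Rightarrow> bool" and S :: "'a set" and f :: "'a \<Rightarrow> nat" and s :: nat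
  assumes graph: "graph V E" and connected: "connected_graph V E"
    and S_subset: "S \<subseteq> V" and card_S: "card S = s" and s_pos: "1 \<le> s"
    and f_S: "\<And>u. u \<in> S \<Longrightarrow> f u = Suc s" and f_image: "f ` (V - S) = {..s}"
    and separated: "\<And>u v. u \<in> V - S \<Longrightarrow> v \<in> V - S \<Longrightarrow> E u v \<Longrightarrow> f u = f v"
    and largest: "\<And>i. i \<le> s \<Longrightarrow> card {u \<in> V. f u = i} \<le> card {u \<in> V. f u = 0}"

lemma exists_separated_graph:
  assumes G: "graph V E" "connected_graph V E" and nt: "\<not> tough V E 1"
  obtains S f where "separated_graph V E S f (card S)"
proof -
  have fin: "finite V" using G by (simp add: graph_def)
  obtain S where S: "S \<subseteq> V" "1 \<le> card S" "card S < num_components (V - S) E"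
    using exists_violating_cut[OF assms] by blast
  let ?W = "V - S" let ?s = "card S"
  define comp where "comp v = {u \<in> ?W. (adj_in ?W E)\<^sup>*\<^sup>* v u}" for v
  let ?C = "comp ` ?W"
  have C: "?C = Defs.components ?W E" by (simp add: Defs.components_def comp_def)
  have finC: "finite ?C" using fin by simp
  have cardC: "?s < card ?C" using S(3) by (simp add: num_components_def C)
  obtain h where h: "bij_betw h ?C {0..<card ?C}" using ex_bij_betw_finite_nat[OF finC] by blast
  \<comment> \<open>Truncation at \<open>card S\<close> merges all components numbered
    \<open>card S\<close> or more, leaving exactly \<open>card S + 1\<close> parts.\<close>
  define f0 where "f0 u = min (h (comp u)) ?s" for u
  have img: "f0 ` ?W = {..?s}"
  proof -
    have "f0 ` ?W = (\<lambda>i. min i ?s) ` h ` ?C" by (auto simp: f0_def image_image)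
    also have "\<dots> = (\<lambda>i. min i ?s) ` {0..<card ?C}" using h by (simp add: bij_betw_def)
    also have "\<dots> = {..?s}"
    proof
      show "{..?s} \<subseteq> (\<lambda>i. min i ?s) ` {0..<card ?C}"
      proof
        fix i assume "i \<in> {..?s}"
        then show "i \<in> (\<lambda>i. min i ?s) ` {0..<card ?C}"
          using cardC by (intro image_eqI[of _ _ i]) auto
      qed
    qed auto
    finally show ?thesis .
  qed
  have step: "comp u = comp v" if "u \<in> ?W" "v \<in> ?W" "E u v" for u v
  proof -
    have "adj_in ?W E u v" "adj_in ?W E v u"
      using that G(1) by (auto simp: adj_in_def graph_def)
    then show ?thesis unfolding comp_def
      by (auto intro: converse_rtranclp_into_rtranclp)
  qed
  let ?P0 = "\<lambda>i. {u \<in> ?W. f0 u = i}"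
  have "Max ((\<lambda>i. card (?P0 i)) ` {..?s}) \<in> (\<lambda>i. card (?P0 i)) ` {..?s}" by (rule Max_in) auto
  then obtain j where "j \<in> {..?s}" and jM: "Max ((\<lambda>i. card (?P0 i)) ` {..?s}) = card (?P0 j)"
    by (rule imageE)
  then have j: "j \<le> ?s" by simp
  have jmax: "card (?P0 i) \<le> card (?P0 j)" if "i \<le> ?s" for i
    unfolding jM[symmetric] using that by (intro Max_ge) auto
  \<comment> \<open>The transposition of 0 and \<open>j\<close>, which moves a largest part to label
    0.\<close>
  define t where "t i = (if i = 0 then j else if i = j then 0 else i)" for i :: nat
  have tt: "t (t i) = i" for i by (simp add: t_def)
  have t_img: "t ` {..?s} = {..?s}"
  proof -
    have "t i \<le> ?s" if "i \<le> ?s" for i using that j by (simp add: t_def)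
    then have sub: "t ` {..?s} \<subseteq> {..?s}" by auto
    moreover have "{..?s} \<subseteq> t ` {..?s}"
    proof
      fix i assume "i \<in> {..?s}"
      then have "t i \<in> {..?s}" using sub by blast
      then show "i \<in> t ` {..?s}" using tt[of i] by (metis image_eqI)
    qed
    ultimately show ?thesis by blast
  qed
  define f where "f u = (if u \<in> S then Suc ?s else t (f0 u))" for u
  have Pi: "{u \<in> V. f u = i} = ?P0 (t i)" if "i \<le> ?s" for i
    using that tt by (auto simp: f_def)
  have "separated_graph V E S f ?s"
  proof
    show "f ` ?W = {..?s}"
    proof -
      have "f ` ?W = t ` f0 ` ?W" by (auto simp: f_def image_image)
      then show ?thesis using img t_img by simp
    qed
    show "f u = f v" if "u \<in> ?W" "v \<in> ?W" "E u v" for u v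
      using that step[OF that] by (simp add: f_def f0_def)
    show "card {u \<in> V. f u = i} \<le> card {u \<in> V. f u = 0}" if "i \<le> ?s" for i
    proof -
      have "t i \<le> ?s" using t_img that by blast
      then show ?thesis using jmax[of "t i"] that by (simp add: Pi t_def)
    qed
  qed (use S G in \<open>auto simp: f_def\<close>)
  then show thesis by (rule that)
qed

section \<open>Part sizes and the Rayleigh bound for weights on the parts\<close>

context separated_graph
begin

definition part_size :: "nat \<Rightarrow> nat" where "part_size i = card {u \<in> V. f u = i}"

lemma finite_V: "finite V" using graph by (simp add: graph_def)

lemma f_V: "f ` V \<subseteq> {..Suc s}"
proof
  fix i assume "i \<in> f ` V"
  then obtain u where u: "u \<in> V" "i = f u" by blast
  show "i \<in> {..Suc s}"
  proof (cases "u \<in> S")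
    case True then show ?thesis using f_S u by simp
  next
    case False
    then have "f u \<in> {..s}" using f_image u by blast
    then show ?thesis using u by simp
  qed
qed

lemma part_S: "{u \<in> V. f u = Suc s} = S"
proof -
  have "f u \<le> s" if "u \<in> V - S" for u using f_image that by blast
  then show ?thesis using S_subset f_S by fastforce
qed

lemma part_size_S: "part_size (Suc s) = s"
  by (simp add: part_size_def part_S card_S)

lemma part_outside_S: "i \<le> s \<Longrightarrow> {u \<in> V. f u = i} = {u \<in> V - S. f u = i}"
  using f_S by auto

lemma part_size_pos: "i \<le> s \<Longrightarrow> 1 \<le> part_size i"
proof -
  assume "i \<le> s"
  then obtain u where "u \<in> V - S" "f u = i" using f_image by (metis atMost_iff imageE)
  then have "{u \<in> V. f u = i} \<noteq> {}" by blast
  then show ?thesis using finite_V by (simp add: part_size_def Suc_le_eq card_gt_0_iff)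
qed

lemma part_size_le: "i \<le> s \<Longrightarrow> part_size i \<le> part_size 0"
  unfolding part_size_def by (rule largest)

lemma sum_over_parts:
  fixes g :: "'a \<Rightarrow> real"
  shows "(\<Sum>i\<le>Suc s. \<Sum>u\<in>{u \<in> V. f u = i}. g u) = (\<Sum>u\<in>V. g u)"
  by (rule sum.group[OF finite_V _ f_V]) simp

lemma sum_part_size: "(\<Sum>i\<le>s. real (part_size i)) + real s = real (card V)"
  using sum_over_parts[of "\<lambda>_. 1"] by (simp add: part_size_S flip: part_size_def)

text \<open>A vertex of part \<open>i\<close> has all its neighbours in \<open>S\<close> and among
  the other vertices of its own part.\<close>

lemma part_size_ge_of_min_degree:
  assumes "\<And>v. v \<in> V \<Longrightarrow> \<delta> \<le> degree V E v" "i \<le> s"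
  shows "\<delta> + 1 \<le> s + part_size i"
proof -
  obtain v where v: "v \<in> V - S" "f v = i" using f_image assms(2) by (metis atMost_iff imageE)
  let ?P = "{u \<in> V. f u = i}"
  have "{u \<in> V. E v u} \<subseteq> S \<union> (?P - {v})"
  proof
    fix u assume u: "u \<in> {u \<in> V. E v u}"
    then have "u \<noteq> v" using graph by (auto simp: graph_def)
    moreover have "f u = i" if "u \<notin> S" using separated[OF v(1), of u] u v that by simp
    ultimately show "u \<in> S \<union> (?P - {v})" using u by blast
  qed
  then have "card {u \<in> V. E v u} \<le> card (S \<union> (?P - {v}))"
    using finite_V S_subset finite_subset by (intro card_mono) auto
  also have "\<dots> \<le> card S + card (?P - {v})" by (rule card_Un_le)
  also have "card (?P - {v}) = part_size i - 1" using v by (simp add: part_size_def)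
  finally show ?thesis using assms(1)[of v] v part_size_pos[OF assms(2)] by (simp add: degree_def card_S)
qed

text \<open>The separation bound for a vector with \<open>na i\<close> entries \<open>a\<close>,
  \<open>nc i\<close> entries \<open>c\<close> and the rest \<open>b\<close> on part
  \<open>i\<close>; \<open>y i\<close> and \<open>N i\<close> are the resulting sum and squared
  norm, and index \<open>Suc s\<close> stands for \<open>S\<close>.\<close>

lemma weighted_bound:
  fixes a b c :: real and na nc :: "nat \<Rightarrow> nat" and y N :: "nat \<Rightarrow> real"
  assumes pos: "0 < a" "0 < b" "0 < c"
    and le: "\<And>i. i \<le> Suc s \<Longrightarrow> na i + nc i \<le> part_size i"
    and y: "\<And>i. i \<le> Suc s \<Longrightarrow> y i = na i * a + nc i * c + (real (part_size i) - na i - nc i) * b"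
    and N: "\<And>i. i \<le> Suc s \<Longrightarrow> N i = na i * a\<^sup>2 + nc i * c\<^sup>2 + (real (part_size i) - na i - nc i) * b\<^sup>2"
  shows "((\<Sum>i\<le>s. y i) + y (Suc s))\<^sup>2 + (\<Sum>i\<le>s. y i)\<^sup>2 - (\<Sum>i\<le>s. (y i)\<^sup>2)
      \<le> (dist_spectral_radius V E + 1) * ((\<Sum>i\<le>s. N i) + N (Suc s))"
    and "\<lbrakk>((\<Sum>i\<le>s. y i) + y (Suc s))\<^sup>2 + (\<Sum>i\<le>s. y i)\<^sup>2 - (\<Sum>i\<le>s. (y i)\<^sup>2)
      = (dist_spectral_radius V E + 1) * ((\<Sum>i\<le>s. N i) + N (Suc s));
      u \<in> V; v \<in> V; u \<noteq> v; u \<in> S \<or> v \<in> S \<or> f u = f v\<rbrakk> \<Longrightarrow> E u v"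
proof -
  obtain x where x: "\<And>u. x u \<in> {a, b, c}"
    and h: "\<And>i h. i \<in> {..Suc s} \<Longrightarrow> (\<Sum>u\<in>{u \<in> V. f u = i}. h (x u))
       = real (na i) * h a + real (nc i) * h c + real (card {u \<in> V. f u = i} - na i - nc i) * h b"
    using three_valued_function[of V "{..Suc s}" na nc f a b c, OF finite_V le[unfolded part_size_def]]
    unfolding atMost_iff by blast
  have xpos: "0 < x u" for u using x[of u] pos by auto
  have r: "real (card {u \<in> V. f u = i} - na i - nc i) = real (part_size i) - na i - nc i" if "i \<le> Suc s" for i
    using le[OF that] by (simp add: part_size_def)
  have sy: "(\<Sum>u\<in>{u \<in> V. f u = i}. x u) = y i" if "i \<le> Suc s" for i
    using h[of i "\<lambda>t. t"] that r y by simp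
  have sN: "(\<Sum>u\<in>{u \<in> V. f u = i}. (x u)\<^sup>2) = N i" if "i \<le> Suc s" for i
    using h[of i "\<lambda>t. t\<^sup>2"] that r N by simp
  have W: "{u \<in> V - S. f u = i} = {u \<in> V. f u = i}" if "i \<le> s" for i
    using part_outside_S that by simp
  have s1: "(\<Sum>u\<in>V. x u) = (\<Sum>i\<le>s. y i) + y (Suc s)"
    using sy by (subst sum_over_parts[symmetric]) simp
  have s2: "(\<Sum>u\<in>V. (x u)\<^sup>2) = (\<Sum>i\<le>s. N i) + N (Suc s)"
    using sN by (subst sum_over_parts[symmetric]) simp
  have s3: "(\<Sum>i\<in>{..s}. (\<Sum>u\<in>{u\<in>V - S. f u = i}. x u)\<^sup>2) = (\<Sum>i\<le>s. (y i)\<^sup>2)"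
    using sy W by (intro sum.cong) auto
  have s4: "(\<Sum>u\<in>V - S. x u) = (\<Sum>i\<le>s. y i)"
  proof -
    have "(\<Sum>u\<in>V - S. x u) = (\<Sum>i\<in>{..s}. \<Sum>u\<in>{u\<in>V - S. f u = i}. x u)"
      using finite_V f_image by (subst sum.group) auto
    also have "\<dots> = (\<Sum>i\<le>s. y i)" using sy W by (intro sum.cong) auto
    finally show ?thesis .
  qed
  note bound = dist_spectral_radius_separation[where x = x, OF graph connected Diff_subset finite_atMost
      eq_refl[OF f_image], unfolded s1 s2 s3 s4]
  show "((\<Sum>i\<le>s. y i) + y (Suc s))\<^sup>2 + (\<Sum>i\<le>s. y i)\<^sup>2 - (\<Sum>i\<le>s. (y i)\<^sup>2)
      \<le> (dist_spectral_radius V E + 1) * ((\<Sum>i\<le>s. N i) + N (Suc s))"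
    by (rule bound(1)) (simp_all add: separated xpos)
  assume "((\<Sum>i\<le>s. y i) + y (Suc s))\<^sup>2 + (\<Sum>i\<le>s. y i)\<^sup>2 - (\<Sum>i\<le>s. (y i)\<^sup>2)
      = (dist_spectral_radius V E + 1) * ((\<Sum>i\<le>s. N i) + N (Suc s))"
    "u \<in> V" "v \<in> V" "u \<noteq> v" "u \<in> S \<or> v \<in> S \<or> f u = f v"
  then show "E u v"
    by (intro bound(2)) (auto simp: xpos intro: separated)
qed

end

section \<open>The three ranges of the cut size\<close>

context separated_graph
begin

lemma sum_split_first:
  fixes g :: "nat \<Rightarrow> real"
  assumes "1 \<le> j" "j \<le> s"
  shows "(\<Sum>i\<le>s. g i) = g 0 + (\<Sum>i\<in>{1..j}. g i) + (\<Sum>i\<in>{Suc j..s}. g i)"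
proof -
  have "{..s} = insert 0 ({1..j} \<union> {Suc j..s})" using assms by auto
  then show ?thesis by (simp add: sum.union_disjoint)
qed

text \<open>Rearrangement of the Perron weights for \<open>s < \<delta>\<close>: \<open>S\<close>
  gets \<open>a\<close>, the \<open>\<delta> - s\<close> remaining copies of \<open>a\<close> go to
  the largest part, \<open>\<delta> - s + 1\<close> copies of \<open>c\<close> to part 1 and one to
  each later part. The minimum degree guarantees the room.\<close>

lemma small_cut_contradiction:
  assumes w: "extremal_weights (real (card V)) (real \<delta>) r a b c"
    and n: "8 * \<delta> \<le> card V" and s: "s < \<delta>"
    and deg: "\<And>v. v \<in> V \<Longrightarrow> \<delta> \<le> degree V E v"
    and rad: "dist_spectral_radius V E + 1 \<le> r"
  shows False
proof -
  define n where "n = real (card V)"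
  define d where "d = real \<delta>"
  define p where "p i = real (part_size i)" for i
  define J where "J = {2..s}"
  define Y where "Y = (\<Sum>i\<in>J. p i - 1)"
  define Z where "Z = (\<Sum>i\<in>J. (p i - 1)\<^sup>2)"
  have w': "0 < a" "a \<le> b" "a \<le> c" "c < 2 * a" using w by (auto simp: extremal_weights_def)
  have sum1: "d * a + (n - 2 * d) * b + d * c = 1"
    using w by (simp add: extremal_weights_def n_def d_def)
  have ge: "\<delta> + 1 \<le> s + part_size i" if "i \<le> s" for i
    using part_size_ge_of_min_degree[OF deg that] .
  have ge': "d - s + 1 \<le> p i" if "i \<le> s" for i
    using ge[OF that] by (simp add: p_def d_def)
  define na where "na i = (if i = Suc s then s else if i = 0 then \<delta> - s else 0)" for i
  define nc where "nc i = (if i = 1 then \<delta> - s + 1 else if i \<in> J then 1 else 0)" for i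
  define y where "y i = na i * a + nc i * c + (p i - na i - nc i) * b" for i
  define N where "N i = na i * a\<^sup>2 + nc i * c\<^sup>2 + (p i - na i - nc i) * b\<^sup>2" for i
  have split: "(\<Sum>i\<le>s. g i) = g 0 + g 1 + (\<Sum>i\<in>J. g i)" for g :: "nat \<Rightarrow> real"
    using sum_split_first[of 1 g] s_pos by (simp add: J_def numeral_2_eq_2)
  have le: "na i + nc i \<le> part_size i" if "i \<le> Suc s" for i
  proof -
    have "i = Suc s \<or> i = 0 \<or> (i = 1 \<and> i \<noteq> Suc s) \<or> i \<in> J" using that by (auto simp: J_def)
    then consider "i = Suc s" | "i = 0" | "i = 1" "i \<noteq> Suc s" | "i \<in> J" by blast
    then show ?thesis
    proof cases
      case 1 then show ?thesis using s_pos by (simp add: na_def nc_def J_def part_size_S)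
    next
      case 2 then show ?thesis using ge[of 0] by (simp add: na_def nc_def J_def)
    next
      case 3 then show ?thesis using ge[of 1] s s_pos by (simp add: na_def nc_def J_def)
    next
      case 4 then show ?thesis using part_size_pos[of i] by (simp add: na_def nc_def J_def)
    qed
  qed
  have "((\<Sum>i\<le>s. y i) + y (Suc s))\<^sup>2 + (\<Sum>i\<le>s. y i)\<^sup>2 - (\<Sum>i\<le>s. (y i)\<^sup>2)
      \<le> (dist_spectral_radius V E + 1) * ((\<Sum>i\<le>s. N i) + N (Suc s))"
    by (rule weighted_bound[of a b c na nc]) (use w' le in \<open>auto simp: y_def N_def p_def\<close>)
  moreover
  define \<alpha> where "\<alpha> = p 0 - (d - s)"
  define m where "m = p 1 - (d - s + 1)"
  have ds: "real (\<delta> - s) = d - s" using s by (simp add: d_def)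
  have y0: "y 0 = (d - s) * a + \<alpha> * b" "N 0 = (d - s) * a\<^sup>2 + \<alpha> * b\<^sup>2"
    by (simp_all add: y_def N_def na_def nc_def J_def ds \<alpha>_def)
  have y1: "y 1 = (d - s + 1) * c + m * b" "N 1 = (d - s + 1) * c\<^sup>2 + m * b\<^sup>2"
    using s_pos by (simp_all add: y_def N_def na_def nc_def J_def ds m_def algebra_simps)
  have yJ: "y i = c + (p i - 1) * b" "N i = c\<^sup>2 + (p i - 1) * b\<^sup>2" if "i \<in> J" for i
    using that by (auto simp: y_def N_def na_def nc_def J_def)
  have yS: "y (Suc s) = s * a" "N (Suc s) = s * a\<^sup>2"
    using s_pos by (simp_all add: y_def N_def na_def nc_def J_def p_def part_size_S)
  have cJ: "real (card J) = real s - 1" using s_pos by (simp add: J_def)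
  have sJ: "(\<Sum>i\<in>J. y i) = (real s - 1) * c + Y * b" "(\<Sum>i\<in>J. N i) = (real s - 1) * c\<^sup>2 + Y * b\<^sup>2"
    using cJ by (simp_all add: yJ sum.distrib Y_def flip: sum_distrib_right)
  have sqJ: "(\<Sum>i\<in>J. (y i)\<^sup>2) = (real s - 1) * c\<^sup>2 + 2 * c * b * Y + b\<^sup>2 * Z"
  proof -
    have "(\<Sum>i\<in>J. (y i)\<^sup>2) = (\<Sum>i\<in>J. c\<^sup>2 + 2 * c * b * (p i - 1) + b\<^sup>2 * (p i - 1)\<^sup>2)"
      by (intro sum.cong refl) (simp add: yJ power2_eq_square algebra_simps)
    then show ?thesis using cJ by (simp add: sum.distrib Y_def Z_def flip: sum_distrib_left)
  qed
  have np: "n = s + p 0 + p 1 + (\<Sum>i\<in>J. p i)"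
    using sum_part_size unfolding n_def p_def split by simp
  have "(\<Sum>i\<in>J. p i) = Y + (real s - 1)" using cJ by (simp add: Y_def sum_subtractf)
  then have nb: "n - 2 * d = \<alpha> + m + Y" and nn: "n = 2 * real s - 1 + p 0 + p 1 + Y"
    using np by (simp_all add: \<alpha>_def m_def)
  \<comment> \<open>Total weight and norm agree with those of the Perron vector, so
    \<open>extremal_weights_norm\<close> applies and only the separated pairs matter.\<close>
  have total: "(\<Sum>i\<le>s. y i) + y (Suc s) = 1"
    unfolding split y0 y1 sJ yS sum1[symmetric] nb by (simp add: algebra_simps)
  have norm: "(\<Sum>i\<le>s. N i) + N (Suc s) = d * a\<^sup>2 + (n - 2 * d) * b\<^sup>2 + d * c\<^sup>2"
    unfolding split y0 y1 sJ yS nb by (simp add: algebra_simps)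
  have p1: "1 \<le> p i" if "i \<le> s" for i using part_size_pos[OF that] by (simp add: p_def)
  have Yp: "0 \<le> Y" "Z \<le> Y\<^sup>2" unfolding Y_def Z_def
    using p1 by (auto intro!: sum_nonneg sum_power2_le_power2_sum simp: J_def)
  have "d * (d - 1) * c\<^sup>2 + 2 * d * (\<alpha> + m + Y) * (b * c)
    < ((d - s) * a + \<alpha> * b + ((d - s + 1) * c + m * b) + ((real s - 1) * c + Y * b))\<^sup>2
      - ((d - s) * a + \<alpha> * b)\<^sup>2 - ((d - s + 1) * c + m * b)\<^sup>2
      - ((real s - 1) * c\<^sup>2 + 2 * c * b * Y + b\<^sup>2 * Z)"
  proof (rule small_cut_gain)
    show "1 \<le> real s" using s_pos by simp
    show "real s + 1 \<le> d" using s by (simp add: d_def)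
    show "1 \<le> \<alpha>" using ge'[of 0] by (simp add: \<alpha>_def)
    show "0 \<le> m" using ge'[of 1] s_pos by (simp add: m_def)
    \<comment> \<open>Part 1 is no larger than part 0, so \<open>8 * d \<le> n\<close> together with
      the count \<open>nn\<close> forces \<open>p 0 + Y\<close> to be large.\<close>
    have "p 1 \<le> p 0" using part_size_le[of 1] s_pos by (simp add: p_def)
    moreover have "8 * d \<le> n" using n by (simp add: d_def n_def)
    ultimately show "2 * (d - s + 1) \<le> \<alpha> + (d - s) + Y"
      using nn Yp(1) \<open>1 \<le> real s\<close> \<open>real s + 1 \<le> d\<close> unfolding \<alpha>_def by argo
  qed (use w' Yp in auto)
  then have "1 + d * (d - 1) * c\<^sup>2 + 2 * d * (n - 2 * d) * (b * c)
     < ((\<Sum>i\<le>s. y i) + y (Suc s))\<^sup>2 + (\<Sum>i\<le>s. y i)\<^sup>2 - (\<Sum>i\<le>s. (y i)\<^sup>2)"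
    unfolding total unfolding split y0 y1 sJ sqJ nb by simp
  moreover have "(dist_spectral_radius V E + 1) * ((\<Sum>i\<le>s. N i) + N (Suc s))
     \<le> 1 + d * (d - 1) * c\<^sup>2 + 2 * d * (n - 2 * d) * (b * c)"
  proof -
    have "0 \<le> (\<Sum>i\<le>s. N i) + N (Suc s)"
      using le by (auto intro!: add_nonneg_nonneg sum_nonneg simp: N_def p_def)
        (smt (verit) le le_Suc_eq mult_nonneg_nonneg of_nat_add of_nat_le_iff order_refl zero_le_power2)+
    then have "(dist_spectral_radius V E + 1) * ((\<Sum>i\<le>s. N i) + N (Suc s))
        \<le> r * ((\<Sum>i\<le>s. N i) + N (Suc s))"
      using rad by (intro mult_right_mono)
    also have "\<dots> = 1 + d * (d - 1) * c\<^sup>2 + 2 * d * (n - 2 * d) * (b * c)"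
      unfolding norm using extremal_weights_norm[OF w] by (simp add: n_def d_def)
    finally show ?thesis .
  qed
  ultimately show False by linarith
qed

text \<open>Rearrangement for \<open>s \<ge> \<delta>\<close>: in \<open>S\<close>,
  \<open>\<delta>\<close> vertices get \<open>a\<close> and the \<open>k\<close> others
  \<open>b\<close>; one vertex in each of the parts 1 to \<open>\<delta>\<close> gets
  \<open>c\<close>, everything else \<open>b\<close>. The bounds close up to an equality, whose
  analysis determines the structure of the graph.\<close>

lemma large_cut:
  assumes w: "extremal_weights (real (card V)) (real \<delta>) r a b c"
    and d: "1 \<le> \<delta>" and s: "s = \<delta> \<or> \<delta> < s \<and> 2 * \<delta> + 2 * s \<le> card V"
    and rad: "dist_spectral_radius V E + 1 \<le> r"
  shows "s = \<delta>" "i \<in> {1..s} \<Longrightarrow> part_size i = 1"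
    "\<lbrakk>u \<in> V; v \<in> V; u \<noteq> v; u \<in> S \<or> v \<in> S \<or> f u = f v\<rbrakk> \<Longrightarrow> E u v"
proof -
  have \<delta>s: "\<delta> \<le> s" using s by auto
  define n where "n = real (card V)"
  define d where "d = real \<delta>"
  define k where "k = real s - d"
  define p where "p i = real (part_size i)" for i
  define J1 where "J1 = {1..\<delta>}"
  define J2 where "J2 = {Suc \<delta>..s}"
  define Y1 where "Y1 = (\<Sum>i\<in>J1. p i - 1)"
  define Z1 where "Z1 = (\<Sum>i\<in>J1. (p i - 1)\<^sup>2)"
  define Y2 where "Y2 = (\<Sum>i\<in>J2. p i - 1)"
  define Z2 where "Z2 = (\<Sum>i\<in>J2. (p i - 1)\<^sup>2)"
  have w': "0 < a" "a \<le> b" "a \<le> c" "c < 2 * a" using w by (auto simp: extremal_weights_def)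
  have sum1: "d * a + (n - 2 * d) * b + d * c = 1"
    using w by (simp add: extremal_weights_def n_def d_def)
  have p1: "1 \<le> p i" if "i \<le> s" for i using part_size_pos[OF that] by (simp add: p_def)
  define na where "na i = (if i = Suc s then \<delta> else 0)" for i
  define nc where "nc i = (if i \<in> J1 then 1 else 0 :: nat)" for i
  define y where "y i = na i * a + nc i * c + (p i - na i - nc i) * b" for i
  define N where "N i = na i * a\<^sup>2 + nc i * c\<^sup>2 + (p i - na i - nc i) * b\<^sup>2" for i
  have split: "(\<Sum>i\<le>s. g i) = g 0 + (\<Sum>i\<in>J1. g i) + (\<Sum>i\<in>J2. g i)" for g :: "nat \<Rightarrow> real"
    using sum_split_first[of \<delta> g] \<delta>s d by (simp add: J1_def J2_def)
  have le: "na i + nc i \<le> part_size i" if "i \<le> Suc s" for i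
  proof (cases "i = Suc s")
    case True then show ?thesis using \<delta>s by (simp add: na_def nc_def J1_def part_size_S)
  next
    case False then show ?thesis using part_size_pos[of i] that by (simp add: na_def nc_def)
  qed
  note wb = weighted_bound[of a b c na nc y N]
  have bound: "((\<Sum>i\<le>s. y i) + y (Suc s))\<^sup>2 + (\<Sum>i\<le>s. y i)\<^sup>2 - (\<Sum>i\<le>s. (y i)\<^sup>2)
      \<le> (dist_spectral_radius V E + 1) * ((\<Sum>i\<le>s. N i) + N (Suc s))"
    by (rule wb(1)) (use w' le in \<open>auto simp: y_def N_def p_def\<close>)
  have y0: "y 0 = p 0 * b" "N 0 = p 0 * b\<^sup>2"
    by (simp_all add: y_def N_def na_def nc_def J1_def)
  have yJ1: "y i = c + (p i - 1) * b" "N i = c\<^sup>2 + (p i - 1) * b\<^sup>2" if "i \<in> J1" for i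
    using that \<delta>s by (auto simp: y_def N_def na_def nc_def J1_def)
  have yJ2: "y i = b + (p i - 1) * b" "N i = b\<^sup>2 + (p i - 1) * b\<^sup>2" if "i \<in> J2" for i
    using that by (auto simp: y_def N_def na_def nc_def J1_def J2_def algebra_simps)
  have yS: "y (Suc s) = d * a + k * b" "N (Suc s) = d * a\<^sup>2 + k * b\<^sup>2"
    using \<delta>s by (simp_all add: y_def N_def na_def nc_def J1_def p_def part_size_S d_def k_def)
  have cJ: "real (card J1) = d" "real (card J2) = k"
    using \<delta>s by (simp_all add: J1_def J2_def d_def k_def)
  have sJ: "(\<Sum>i\<in>J1. y i) = d * c + Y1 * b" "(\<Sum>i\<in>J1. N i) = d * c\<^sup>2 + Y1 * b\<^sup>2"
    "(\<Sum>i\<in>J2. y i) = k * b + Y2 * b" "(\<Sum>i\<in>J2. N i) = k * b\<^sup>2 + Y2 * b\<^sup>2"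
    using cJ by (simp_all add: yJ1 yJ2 sum.distrib Y1_def Y2_def flip: sum_distrib_right)
  have sqJ1: "(\<Sum>i\<in>J1. (y i)\<^sup>2) = d * c\<^sup>2 + 2 * c * b * Y1 + b\<^sup>2 * Z1"
  proof -
    have "(\<Sum>i\<in>J1. (y i)\<^sup>2) = (\<Sum>i\<in>J1. c\<^sup>2 + 2 * c * b * (p i - 1) + b\<^sup>2 * (p i - 1)\<^sup>2)"
      by (intro sum.cong refl) (simp add: yJ1 power2_eq_square algebra_simps)
    then show ?thesis using cJ by (simp add: sum.distrib Y1_def Z1_def flip: sum_distrib_left)
  qed
  have sqJ2: "(\<Sum>i\<in>J2. (y i)\<^sup>2) = b\<^sup>2 * (k + 2 * Y2 + Z2)"
  proof -
    have "(\<Sum>i\<in>J2. (y i)\<^sup>2) = (\<Sum>i\<in>J2. b\<^sup>2 * (1 + 2 * (p i - 1) + (p i - 1)\<^sup>2))"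
      by (intro sum.cong refl) (simp add: yJ2 power2_eq_square algebra_simps)
    also have "\<dots> = b\<^sup>2 * (\<Sum>i\<in>J2. 1 + 2 * (p i - 1) + (p i - 1)\<^sup>2)"
      by (rule sum_distrib_left[symmetric])
    also have "(\<Sum>i\<in>J2. 1 + 2 * (p i - 1) + (p i - 1)\<^sup>2) = k + 2 * Y2 + Z2"
      using cJ by (simp only: sum.distrib Y2_def Z2_def sum_distrib_left[symmetric]) simp
    finally show ?thesis .
  qed
  have np: "n = s + p 0 + (\<Sum>i\<in>J1. p i) + (\<Sum>i\<in>J2. p i)"
    using sum_part_size unfolding n_def p_def split by simp
  have "(\<Sum>i\<in>J1. p i) = Y1 + d" "(\<Sum>i\<in>J2. p i) = Y2 + k"
    using cJ by (simp_all add: Y1_def Y2_def sum_subtractf)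
  then have nb: "n - 2 * d = 2 * k + p 0 + Y1 + Y2"
    using np by (simp add: k_def)
  have total: "(\<Sum>i\<le>s. y i) + y (Suc s) = 1"
    unfolding split y0 sJ yS sum1[symmetric] nb by (simp add: algebra_simps)
  have norm: "(\<Sum>i\<le>s. N i) + N (Suc s) = d * a\<^sup>2 + (n - 2 * d) * b\<^sup>2 + d * c\<^sup>2"
    unfolding split y0 sJ yS nb by (simp add: algebra_simps)
  have Yp: "0 \<le> Y1" "Z1 \<le> Y1\<^sup>2" "0 \<le> Y2" "Z2 \<le> Y2\<^sup>2" unfolding Y1_def Z1_def Y2_def Z2_def
    using p1 \<delta>s by (auto intro!: sum_nonneg sum_power2_le_power2_sum simp: J1_def J2_def)
  \<comment> \<open>If the largest part is a single vertex, so are all parts, and no surplus is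
    left.\<close>
  have p0: "2 \<le> p 0" if "Y1 + Y2 > 0"
  proof (rule ccontr)
    assume "\<not> 2 \<le> p 0"
    then have "part_size 0 \<le> 1" by (simp add: p_def)
    then have "p i \<le> 1" if "i \<le> s" for i using part_size_le[OF that] by (simp add: p_def)
    then have "Y1 \<le> 0" "Y2 \<le> 0" unfolding Y1_def Y2_def
      using \<delta>s by (auto intro!: sum_nonpos simp: J1_def J2_def)
    then show False using that by simp
  qed
  \<comment> \<open>By \<open>nb\<close>, the sum \<open>p 0 + Y1 + Y2\<close> is
    \<open>n - 2 * s\<close>; the assumption on \<open>card V\<close> bounds it below by
    \<open>2 * d\<close>.\<close>
  have kd: "k = 0 \<or> 1 \<le> k \<and> 2 * d \<le> p 0 + Y1 + Y2"
  proof (cases "s = \<delta>")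
    case False
    then have "\<delta> + 1 \<le> s" "2 * \<delta> + 2 * s \<le> card V" using s by auto
    then have "d + 1 \<le> s" "2 * d + 2 * s \<le> n" unfolding d_def n_def by linarith+
    then show ?thesis using nb by (simp add: k_def)
  qed (simp add: k_def d_def)
  have gain_hyps: "0 \<le> k" "0 < d" "0 < b" "0 < c" "c < 2 * b" "1 \<le> p 0"
    using w' \<delta>s d p1[of 0] by (auto simp: k_def d_def)
  note gain = large_cut_gain[OF gain_hyps(1) kd gain_hyps(2-6) Yp(1,3,2,4) p0]
  have rad': "(dist_spectral_radius V E + 1) * ((\<Sum>i\<le>s. N i) + N (Suc s))
     \<le> 1 + d * (d - 1) * c\<^sup>2 + 2 * d * (n - 2 * d) * (b * c)"
  proof -
    have "0 \<le> (\<Sum>i\<le>s. N i) + N (Suc s)"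
      unfolding norm nb using gain_hyps Yp by (intro add_nonneg_nonneg mult_nonneg_nonneg) auto
    then have "(dist_spectral_radius V E + 1) * ((\<Sum>i\<le>s. N i) + N (Suc s))
        \<le> r * ((\<Sum>i\<le>s. N i) + N (Suc s))"
      using rad by (intro mult_right_mono)
    also have "\<dots> = 1 + d * (d - 1) * c\<^sup>2 + 2 * d * (n - 2 * d) * (b * c)"
      unfolding norm using extremal_weights_norm[OF w] by (simp add: n_def d_def)
    finally show ?thesis .
  qed
  have "1 + d * (d - 1) * c\<^sup>2 + 2 * d * (n - 2 * d) * (b * c)
     \<le> ((\<Sum>i\<le>s. y i) + y (Suc s))\<^sup>2 + (\<Sum>i\<le>s. y i)\<^sup>2 - (\<Sum>i\<le>s. (y i)\<^sup>2)"
    using gain(1) unfolding total unfolding split y0 sJ sqJ1 sqJ2 nb by simp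
  \<comment> \<open>The Rayleigh bound, the bound by \<open>r\<close> and the gain inequality form a
    closed chain. Hence equality holds throughout and the strict gain is impossible, which gives
    \<open>k = 0\<close> and no surplus.\<close>
  then have eq: "((\<Sum>i\<le>s. y i) + y (Suc s))\<^sup>2 + (\<Sum>i\<le>s. y i)\<^sup>2 - (\<Sum>i\<le>s. (y i)\<^sup>2)
      = (dist_spectral_radius V E + 1) * ((\<Sum>i\<le>s. N i) + N (Suc s))"
    using bound rad' by linarith
  have no: "\<not> (k > 0 \<or> Y1 + Y2 > 0)"
  proof
    assume "k > 0 \<or> Y1 + Y2 > 0"
    from gain(2)[OF _ this] have "1 + d * (d - 1) * c\<^sup>2 + 2 * d * (n - 2 * d) * (b * c)
       < ((\<Sum>i\<le>s. y i) + y (Suc s))\<^sup>2 + (\<Sum>i\<le>s. y i)\<^sup>2 - (\<Sum>i\<le>s. (y i)\<^sup>2)"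
      unfolding total unfolding split y0 sJ sqJ1 sqJ2 nb by simp
    then show False using bound rad' by linarith
  qed
  show s\<delta>: "s = \<delta>" using no \<delta>s by (simp add: k_def d_def)
  show "part_size i = 1" if "i \<in> {1..s}"
  proof -
    have "Y1 = 0" using no Yp by linarith
    then have "p i - 1 = 0" using that s\<delta> p1 unfolding Y1_def
      by (subst (asm) sum_nonneg_eq_0_iff) (auto simp: J1_def)
    then show ?thesis by (simp add: p_def)
  qed
  assume uv: "u \<in> V" "v \<in> V" "u \<noteq> v" "u \<in> S \<or> v \<in> S \<or> f u = f v"
  show "E u v"
    by (rule wb(2)[OF _ _ _ _ _ _ eq uv]) (use w' le in \<open>auto simp: y_def N_def p_def\<close>)
qed

text \<open>Here \<open>n - 2 * s\<close> is below \<open>2 * \<delta>\<close>, so the condition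
  \<open>kd\<close> behind the Perron weights fails. Weight \<open>3/2\<close> on one vertex of each
  part except part 0, and 1 elsewhere, is compared with the explicit bound on \<open>r\<close>
  instead.\<close>

lemma very_large_cut_contradiction:
  assumes w: "extremal_weights (real (card V)) (real \<delta>) r a b c"
    and d: "2 \<le> \<delta>" and n: "8 * \<delta> \<le> card V" "card V < 2 * \<delta> + 2 * s"
    and rad: "dist_spectral_radius V E + 1 \<le> r"
  shows False
proof -
  define p where "p i = real (part_size i)" for i
  define J where "J = {1..s}"
  define Y where "Y = (\<Sum>i\<in>J. p i - 1)"
  define Z where "Z = (\<Sum>i\<in>J. (p i - 1)\<^sup>2)"
  have p1: "1 \<le> p i" if "i \<le> s" for i using part_size_pos[OF that] by (simp add: p_def)
  define nc where "nc i = (if i \<in> J then 1 else 0 :: nat)" for i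
  define y where "y i = nc i * (3/2) + (p i - nc i)" for i
  define N where "N i = nc i * (9/4) + (p i - nc i)" for i
  have split: "(\<Sum>i\<le>s. g i) = g 0 + (\<Sum>i\<in>J. g i)" for g :: "nat \<Rightarrow> real"
    using sum_split_first[of s g] s_pos by (simp add: J_def)
  have le: "nc i \<le> part_size i" if "i \<le> Suc s" for i
    using part_size_pos[of i] by (auto simp: nc_def J_def)
  have bound: "((\<Sum>i\<le>s. y i) + y (Suc s))\<^sup>2 + (\<Sum>i\<le>s. y i)\<^sup>2 - (\<Sum>i\<le>s. (y i)\<^sup>2)
      \<le> (dist_spectral_radius V E + 1) * ((\<Sum>i\<le>s. N i) + N (Suc s))"
    by (rule weighted_bound[of 1 1 "3/2" "\<lambda>_. 0" nc])
      (use le in \<open>auto simp: y_def N_def p_def power2_eq_square\<close>)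
  have y0: "y 0 = p 0" "N 0 = p 0" by (simp_all add: y_def N_def nc_def J_def)
  have yJ: "y i = 3/2 + (p i - 1)" "N i = 9/4 + (p i - 1)" if "i \<in> J" for i
    using that by (auto simp: y_def N_def nc_def)
  have yS: "y (Suc s) = s" "N (Suc s) = s"
    by (simp_all add: y_def N_def nc_def J_def p_def part_size_S)
  have cJ: "real (card J) = s" by (simp add: J_def)
  have sJ: "(\<Sum>i\<in>J. y i) = 3/2 * s + Y" "(\<Sum>i\<in>J. N i) = 9/4 * s + Y"
  proof -
    have "(\<Sum>i\<in>J. y i) = (\<Sum>i\<in>J. 3/2 + (p i - 1))" "(\<Sum>i\<in>J. N i) = (\<Sum>i\<in>J. 9/4 + (p i - 1))"
      by (intro sum.cong refl; simp add: yJ)+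
    then show "(\<Sum>i\<in>J. y i) = 3/2 * s + Y" "(\<Sum>i\<in>J. N i) = 9/4 * s + Y"
      using cJ by (simp_all only: sum.distrib Y_def sum_constant)
  qed
  have sqJ: "(\<Sum>i\<in>J. (y i)\<^sup>2) = 9/4 * s + 3 * Y + Z"
  proof -
    have "(\<Sum>i\<in>J. (y i)\<^sup>2) = (\<Sum>i\<in>J. 9/4 + 3 * (p i - 1) + (p i - 1)\<^sup>2)"
      by (intro sum.cong refl) (simp add: yJ power2_eq_square algebra_simps)
    then show ?thesis
      using cJ by (simp only: sum.distrib Y_def Z_def sum_distrib_left[symmetric] sum_constant)
  qed
  have np: "real (card V) = 2 * real s + p 0 + Y"
  proof -
    have "(\<Sum>i\<in>J. p i) = Y + s" using cJ by (simp add: Y_def sum_subtractf)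
    then show ?thesis using sum_part_size unfolding p_def[symmetric] split by simp
  qed
  have Yp: "0 \<le> Y" "Z \<le> Y\<^sup>2" unfolding Y_def Z_def
    using p1 by (auto intro!: sum_nonneg sum_power2_le_power2_sum simp: J_def)
  have p0: "2 \<le> p 0" if "Y > 0"
  proof (rule ccontr)
    assume "\<not> 2 \<le> p 0"
    then have "part_size 0 \<le> 1" by (simp add: p_def)
    then have "p i \<le> 1" if "i \<le> s" for i using part_size_le[OF that] by (simp add: p_def)
    then have "Y \<le> 0" unfolding Y_def by (auto intro!: sum_nonpos simp: J_def)
    then show False using that by simp
  qed
  \<comment> \<open>With \<open>\<delta> \<ge> 2\<close> this yields \<open>s > 6\<close>, and also
    \<open>p 0 + Y = n - 2 * s < 2 * \<delta> < s\<close>.\<close>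
  have s3: "3 * \<delta> < s" using n by linarith
  have "r * (s + p 0 + (9/4 * s + Y))
    < (s + p 0 + (3/2 * s + Y))\<^sup>2 + (p 0 + (3/2 * s + Y))\<^sup>2 - (p 0)\<^sup>2 - (9/4 * s + 3 * Y + Z)"
  proof (rule very_large_cut_gain)
    show "6 < real s" using s3 d by linarith
    show "p 0 + Y \<le> s" using np n s3 by linarith
    show "r < 1273/1000 * (2 * real s + p 0 + Y)"
      using extremal_weights_eigenvalue_less[OF w] d n np by simp
  qed (use p1[of 0] Yp p0 in auto)
  moreover have "(dist_spectral_radius V E + 1) * (s + p 0 + (9/4 * s + Y)) \<le> r * (s + p 0 + (9/4 * s + Y))"
    using rad Yp p1[of 0] by (intro mult_right_mono) auto
  ultimately show False using bound unfolding split y0 sJ sqJ yS by (simp add: add_ac)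
qed

section \<open>Recognition of the extremal graph and conclusion\<close>

text \<open>The set \<open>S\<close> becomes the dominating clique, part 0 the middle clique, and
  the \<open>s\<close> singleton parts the isolated vertices; each block is mapped bijectively onto
  its interval of labels.\<close>

lemma graph_iso_extremal:
  assumes parts: "\<And>i. i \<in> {1..s} \<Longrightarrow> part_size i = 1"
    and adj: "\<And>u v. \<lbrakk>u \<in> V; v \<in> V; u \<noteq> v; u \<in> S \<or> v \<in> S \<or> f u = f v\<rbrakk> \<Longrightarrow> E u v"
  shows "graph_iso V E (extremal_vertices (card V)) (extremal_adj (card V) s)"
proof -
  let ?n = "card V"
  let ?A = "{u \<in> V. f u = 0}"
  let ?C = "{u \<in> V. f u \<in> {1..s}}"
  have f_range: "f u \<le> s" if "u \<in> V - S" for u using f_image that by blast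
  have V: "V = S \<union> ?A \<union> ?C" using f_range S_subset by fastforce
  have disj: "S \<inter> ?A = {}" "(S \<union> ?A) \<inter> ?C = {}" using f_S by auto
  have fin: "finite S" "finite ?A" "finite ?C" using finite_V S_subset finite_subset by auto
  have inj: "u = v" if "u \<in> ?C" "v \<in> ?C" "f u = f v" for u v
  proof -
    have "card {w \<in> V. f w = f u} = 1" using parts[of "f u"] that by (simp add: part_size_def)
    then obtain x where "{w \<in> V. f w = f u} = {x}" by (auto simp: card_1_singleton_iff)
    moreover have "u \<in> {w \<in> V. f w = f u}" "v \<in> {w \<in> V. f w = f u}" using that by auto
    ultimately show ?thesis by (metis singletonD)
  qed
  have "f ` ?C = {1..s}"
  proof
    show "{1..s} \<subseteq> f ` ?C"
    proof
      fix i assume i: "i \<in> {1..s}"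
      then have "i \<in> f ` (V - S)" using f_image by simp
      then show "i \<in> f ` ?C" using i by auto
    qed
  qed auto
  then have "bij_betw f ?C {1..s}" using inj by (auto simp: bij_betw_def inj_on_def)
  then have cC: "card ?C = s" using bij_betw_same_card by fastforce
  have "?n = card (S \<union> ?A) + card ?C" using disj(2) fin V by (metis (no_types, lifting) card_Un_disjoint finite_Un)
  then have cA: "?n = 2 * s + card ?A" using disj(1) fin cC card_S by (simp add: card_Un_disjoint)
  have "\<exists>g. bij_betw g S {0..<s}"
    by (rule finite_same_card_bij) (use fin cC cA card_S in simp_all)
  then obtain g1 where g1: "bij_betw g1 S {0..<s}" by blast
  have "\<exists>g. bij_betw g ?A {s..<?n-s}"
    by (rule finite_same_card_bij) (use fin cC cA card_S in simp_all)
  then obtain g2 where g2: "bij_betw g2 ?A {s..<?n-s}" by blast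
  have "\<exists>g. bij_betw g ?C {?n-s..<?n}"
    by (rule finite_same_card_bij) (use fin cC cA card_S in simp_all)
  then obtain g3 where g3: "bij_betw g3 ?C {?n-s..<?n}" by blast
  define g where "g u = (if u \<in> S then g1 u else if u \<in> ?A then g2 u else g3 u)" for u
  have b1: "bij_betw g S {0..<s}" using g1 by (subst bij_betw_cong[of _ _ g1]) (auto simp: g_def)
  have b2: "bij_betw g ?A {s..<?n-s}"
    using g2 disj by (subst bij_betw_cong[of _ _ g2]) (auto simp: g_def)
  have b3: "bij_betw g ?C {?n-s..<?n}"
    using g3 disj by (subst bij_betw_cong[of _ _ g3]) (auto simp: g_def)
  have "bij_betw g (S \<union> ?A \<union> ?C) ({0..<s} \<union> {s..<?n-s} \<union> {?n-s..<?n})"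
    using b1 b2 b3 cA by (intro bij_betw_combine) auto
  moreover have "{0..<s} \<union> {s..<?n-s} \<union> {?n-s..<?n} = {0..<?n}" using cA by auto
  ultimately have bij: "bij_betw g V {0..<?n}" using V by simp
  have gS: "g u < s \<longleftrightarrow> u \<in> S" if "u \<in> V" for u
  proof -
    have "u \<in> S \<Longrightarrow> g u < s" using b1 by (auto dest: bij_betwE)
    moreover have "u \<in> ?A \<Longrightarrow> s \<le> g u" using b2 by (auto dest: bij_betwE)
    moreover have "u \<in> ?C \<Longrightarrow> s \<le> g u" using bij_betwE[OF b3] cA by fastforce
    ultimately show ?thesis using that V by fastforce
  qed
  have gA: "s \<le> g u \<and> g u < ?n - s \<longleftrightarrow> u \<in> ?A" if "u \<in> V" for u
  proof -
    have "u \<in> S \<Longrightarrow> g u < s" using b1 by (auto dest: bij_betwE)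
    moreover have "u \<in> ?A \<Longrightarrow> s \<le> g u \<and> g u < ?n - s" using bij_betwE[OF b2] by simp
    moreover have "u \<in> ?C \<Longrightarrow> ?n - s \<le> g u" using bij_betwE[OF b3] by fastforce
    ultimately show ?thesis using that V by fastforce
  qed
  have iff: "E u v \<longleftrightarrow> u \<noteq> v \<and> (u \<in> S \<or> v \<in> S \<or> u \<in> ?A \<and> v \<in> ?A)" if uv: "u \<in> V" "v \<in> V" for u v
  proof
    assume e: "E u v"
    then have "u \<noteq> v" using graph by (auto simp: graph_def)
    moreover have "u \<in> ?A \<and> v \<in> ?A" if "u \<notin> S" "v \<notin> S"
    proof -
      have "f u = f v" using separated[of u v] e that uv by simp
      moreover have "f u \<le> s" using f_range uv that by simp
      \<comment> \<open>Two distinct vertices in one part exclude the singleton parts, so only part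
        0 remains.\<close>
      ultimately have "f u = 0" using inj[of u v] uv \<open>u \<noteq> v\<close> by (cases "f u") auto
      then show ?thesis using uv \<open>f u = f v\<close> by simp
    qed
    ultimately show "u \<noteq> v \<and> (u \<in> S \<or> v \<in> S \<or> u \<in> ?A \<and> v \<in> ?A)" by blast
  next
    assume "u \<noteq> v \<and> (u \<in> S \<or> v \<in> S \<or> u \<in> ?A \<and> v \<in> ?A)"
    then show "E u v" using adj[OF uv] by auto
  qed
  have "E u v \<longleftrightarrow> extremal_adj ?n s (g u) (g v)" if uv: "u \<in> V" "v \<in> V" for u v
  proof -
    have "g u < ?n" "g v < ?n" using bij_betwE[OF bij] uv by auto
    moreover have "g u = g v \<longleftrightarrow> u = v" using bij uv by (auto simp: bij_betw_def inj_on_def)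
    ultimately show ?thesis
      unfolding iff[OF uv] extremal_adj_def gS[OF uv(1), symmetric] gS[OF uv(2), symmetric]
        gA[OF uv(1), symmetric] gA[OF uv(2), symmetric] by auto
  qed
  then show ?thesis unfolding graph_iso_def extremal_vertices_def using bij by blast
qed

end

theorem theorem1p1:
  fixes V :: "'a set" and E :: "'a \<Rightarrow> 'a \<Rightarrow> bool" and \<delta> n :: nat
  assumes "graph V E"
    and "connected_graph V E"
    and "card V = n"
    and "\<delta> \<ge> 2"
    and "real n \<ge> 8 * real \<delta>"
    and "real n \<ge> (real \<delta>)\<^sup>2 / 2 + 2 * real \<delta> + 2"
    and "min_degree V E = \<delta>"
    and "dist_spectral_radius V E
           \<le> dist_spectral_radius (extremal_vertices n) (extremal_adj n \<delta>)"
  shows "tough V E 1 \<or> graph_iso V E (extremal_vertices n) (extremal_adj n \<delta>)"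
proof (cases "tough V E 1")
  case False
  then obtain S f where "separated_graph V E S f (card S)"
    using exists_separated_graph[OF assms(1,2)] by blast
  then interpret separated_graph V E S f "card S" .
  have n8: "8 * \<delta> \<le> card V" using assms(3,5) by linarith
  obtain r a b c where w: "extremal_weights (real (card V)) (real \<delta>) r a b c"
    using extremal_weights_exist[of "real \<delta>" "real (card V)"] assms(3-5) by auto
  have "dist_spectral_radius (extremal_vertices n) (extremal_adj n \<delta>) \<le> r - 1"
    using extremal_dist_spectral_radius_le[OF w] n8 assms(3,4) by simp
  then have rad: "dist_spectral_radius V E + 1 \<le> r" using assms(8) by linarith
  have deg: "\<delta> \<le> degree V E v" if "v \<in> V" for v
    unfolding assms(7)[symmetric] min_degree_def using that finite_V by simp
  \<comment> \<open>The two extreme ranges of the cut size are contradictory; the middle range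
    remains, where \<open>large_cut\<close> identifies the graph.\<close>
  have "\<delta> \<le> card S" using small_cut_contradiction[OF w n8 _ deg rad] by (meson not_le)
  moreover have "2 * \<delta> + 2 * card S \<le> card V"
    using very_large_cut_contradiction[OF w assms(4) n8 _ rad] by (meson not_le)
  ultimately have "card S = \<delta> \<or> \<delta> < card S \<and> 2 * \<delta> + 2 * card S \<le> card V" by linarith
  note large = large_cut[OF w _ this rad]
  have "card S = \<delta>" using large(1) assms(4) by simp
  moreover have "graph_iso V E (extremal_vertices (card V)) (extremal_adj (card V) (card S))"
    by (rule graph_iso_extremal) (use large(2,3) assms(4) in auto)
  ultimately show ?thesis using assms(3) by simp
qed simp

end
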